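(* Let $n$ be the maximum number of keys, $v \ge 1$ arbitrary the value length in bits, and suppose the key universe satisfies $|\mathcal{U}| \ge n^3$. Then any dynamic retrieval data structure (possibly randomized) requires an expected size of at least $$ nv + \Omega(n \log\log n) $$ bits (on some distribution over sequences of operations).
   Context: A retrieval data structure stores a set $K \subseteq \mathcal{U}$ of at most $n$ keys, each $k\in K$ associated with a $v$-bit value $f(k)$, and answers $\mathrm{Query}(k)$ with $f(k)$ if $k\in K$ and with an arbitrary output if $k\notin K$. A dynamic retrieval data structure supports queries, $\mathrm{Update}(k,f)$ (for $k\in K$, change the value of $k$ to $f$), $\mathrm{Insert}(k,f)$ (for $k\notin K$ with $|K|<n$, add $k$ to $K$ with value $f$), and $\mathrm{Delete}(k)$ (for $k\in K$, remove $k$ from $K$). The size is the number of bits of memory (the encoding of the data structure's state), measured in expectation. Logarithms are base 2. *)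

theory Defs
  imports "HOL-Probability.Probability"
begin

type_synonym bits = "bool list"
type_synonym tape = "nat \<Rightarrow> bool"

datatype operation =
    Query nat
  | Update nat bits
  | Insert nat bits
  | Delete nat

text \<open>The stored data is a partial map: its domain is the current key set and it sends
  every stored key to its value.\<close>

fun apply_op :: "(nat \<rightharpoonup> bits) \<Rightarrow> operation \<Rightarrow> (nat \<rightharpoonup> bits)" where
  "apply_op m (Query k) = m"
| "apply_op m (Update k f) = m(k \<mapsto> f)"
| "apply_op m (Insert k f) = m(k \<mapsto> f)"
| "apply_op m (Delete k) = m(k := None)"

fun admissible :: "nat set \<Rightarrow> nat \<Rightarrow> nat \<Rightarrow> (nat \<rightharpoonup> bits) \<Rightarrow> operation \<Rightarrow> bool" where
  "admissible U n v m (Query k) \<longleftrightarrow> k \<in> U"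
| "admissible U n v m (Update k f) \<longleftrightarrow> k \<in> dom m \<and> length f = v"
| "admissible U n v m (Insert k f) \<longleftrightarrow>
     k \<in> U \<and> k \<notin> dom m \<and> card (dom m) < n \<and> length f = v"
| "admissible U n v m (Delete k) \<longleftrightarrow> k \<in> dom m"

fun admissible_from :: "nat set \<Rightarrow> nat \<Rightarrow> nat \<Rightarrow> (nat \<rightharpoonup> bits) \<Rightarrow> operation list \<Rightarrow> bool" where
  "admissible_from U n v m [] \<longleftrightarrow> True"
| "admissible_from U n v m (x # xs) \<longleftrightarrow>
     admissible U n v m x \<and> admissible_from U n v (apply_op m x) xs"

definition op_sequences :: "nat set \<Rightarrow> nat \<Rightarrow> nat \<Rightarrow> operation list set" where
  "op_sequences U n v = {xs. admissible_from U n v Map.empty xs}"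

definition contents :: "operation list \<Rightarrow> (nat \<rightharpoonup> bits)" where
  "contents xs = foldl apply_op Map.empty xs"

text \<open>A state is the bit string held in memory. Randomness is a tape that every operation
  may read and that is not charged to the memory. The \<open>nat\<close> argument of \<open>step\<close> and
  \<open>answer\<close> is the number of operations performed before; it lets an operation use coins that
  are fresh at that time, so private coins as well as a persistent random seed are covered.
  Queries, like all other operations, may modify the state; \<open>answer\<close> is the output of a query
  asked in the given state.\<close>

record data_structure =
  initial :: "tape \<Rightarrow> bits"
  step :: "tape \<Rightarrow> nat \<Rightarrow> bits \<Rightarrow> operation \<Rightarrow> bits"
  answer :: "tape \<Rightarrow> nat \<Rightarrow> bits \<Rightarrow> nat \<Rightarrow> bits"

fun run_from :: "data_structure \<Rightarrow> tape \<Rightarrow> nat \<Rightarrow> bits \<Rightarrow> operation list \<Rightarrow> bits" where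
  "run_from D \<omega> t s [] = s"
| "run_from D \<omega> t s (x # xs) = run_from D \<omega> (Suc t) (step D \<omega> t s x) xs"

definition state_after :: "data_structure \<Rightarrow> tape \<Rightarrow> operation list \<Rightarrow> bits" where
  "state_after D \<omega> xs = run_from D \<omega> 0 (initial D \<omega>) xs"

text \<open>The measure \<open>M\<close> is the distribution of the tape; independent fair coins, or a point
  mass for a deterministic structure, are special cases. Queries for keys that are not stored
  are unconstrained.\<close>

definition dynamic_retrieval ::
    "nat set \<Rightarrow> nat \<Rightarrow> nat \<Rightarrow> tape measure \<Rightarrow> data_structure \<Rightarrow> bool" where
  "dynamic_retrieval U n v M D \<longleftrightarrow>
     prob_space M \<and>
     (\<forall>xs \<in> op_sequences U n v.
        (\<lambda>\<omega>. state_after D \<omega> xs) \<in> measurable M (count_space UNIV) \<and>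
        (\<forall>\<omega> \<in> space M. \<forall>k f. contents xs k = Some f \<longrightarrow>
           answer D \<omega> (length xs) (state_after D \<omega> xs) k = f))"

text \<open>Expectation over the operation sequence and the tape, drawn independently, of the
  length of the resulting state. It takes values in the extended nonnegative reals, so
  structures of infinite expected size need no special treatment.\<close>

definition expected_size ::
    "tape measure \<Rightarrow> data_structure \<Rightarrow> operation list pmf \<Rightarrow> ennreal" where
  "expected_size M D S =
     (\<integral>\<^sup>+ xs. (\<integral>\<^sup>+ \<omega>. ennreal (real (length (state_after D \<omega> xs))) \<partial>M) \<partial>measure_pmf S)"

end

theory Submission
  imports Defs "HOL-Real_Asymp.Real_Asymp"
begin

text \<open>
  Fix the random tape. Let \<open>m = n div 2\<close>, \<open>p = n - m\<close>, and split the universe into \<open>p\<close> blocks of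
  \<open>q = n\<^sup>2\<close> keys and \<open>p\<close> further fixed keys \<open>C\<close>. The operations insert a set \<open>A\<close> with one random
  key from each of the first \<open>m\<close> blocks together with \<open>C\<close>, then delete \<open>C\<close> and insert a set \<open>B\<close> with
  one random key from each of the \<open>p\<close> blocks; all values are random. The distribution stops after
  either phase with probability 1/2.

  If the sizes exceed \<open>n v\<close> by at most \<open>k\<close> bits, then a typical state \<open>s\<close> after the first phase is
  compatible with a fraction \<open>2\<^sup>-\<^sup>k\<close> of all sets \<open>A\<close>, so the possible keys \<open>W\<close> of \<open>A\<close> fill a fraction of
  about \<open>w = 2 powr - (k / m)\<close> of the blocks. About \<open>m w / 2\<close> keys of \<open>B\<close> lie in \<open>W\<close> and receive a new value.
  As the structure cannot tell which keys of \<open>W\<close> are in \<open>A\<close>, the state \<open>s'\<close> after the second phase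
  has to answer like \<open>s\<close> on all of \<open>W\<close> except for a part that is smaller by a factor of order \<open>n\<close>.
  Hence \<open>s\<close> and \<open>s'\<close> together locate those keys of \<open>B\<close>, at a cost of about \<open>m w log n\<close> bits.
  Thus \<open>k\<close> is at least of order \<open>m 2 powr - (k / m) log n\<close>, that is, of order \<open>n log log n\<close>.
  Everything is done by counting preimages of states, since the encodings are not prefix-free and
  the loss in passing from entropy to length may grow with \<open>v\<close>.
\<close>

section \<open>Counting\<close>

text \<open>For uniform \<open>c\<close> the coordinates are independent, so the moment generating
  function of the number of hits factors, and \<open>1 + x \<le> exp x\<close> bounds each factor.
  Below, \<open>t = 1 / 2\<close> gives a lower tail bound, while \<open>t \<ge> 1\<close> limits
  the number of \<open>c\<close> with many hits.\<close>

lemma sum_power_card_PiE_le: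
  fixes t :: real
  assumes I: "finite I" and X: "\<And>i. i \<in> I \<Longrightarrow> finite (X i)"
    and N: "\<And>i. i \<in> I \<Longrightarrow> card (X i) = N" and "0 < N" "0 \<le> t"
  shows "(\<Sum>c\<in>PiE I X. t ^ card {i\<in>I. P i (c i)})
    \<le> real N ^ card I * exp ((t - 1) * (\<Sum>i\<in>I. real (card {x\<in>X i. P i x})) / real N)"
proof -
  have "(\<Sum>c\<in>PiE I X. t ^ card {i\<in>I. P i (c i)})
      = (\<Sum>c\<in>PiE I X. \<Prod>i\<in>I. if P i (c i) then t else 1)"
    using I by (intro sum.cong refl) (simp add: prod.If_cases Int_def)
  also have "\<dots> = (\<Prod>i\<in>I. \<Sum>x\<in>X i. if P i x then t else 1)"
    using I X by (intro prod_sum_PiE [symmetric]) auto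
  also have "\<dots> \<le> (\<Prod>i\<in>I. real N * exp ((t - 1) * real (card {x\<in>X i. P i x}) / real N))"
  proof (intro prod_mono conjI)
    fix i assume i: "i \<in> I"
    show "0 \<le> (\<Sum>x\<in>X i. if P i x then t else 1)"
      using \<open>0 \<le> t\<close> by (intro sum_nonneg) auto
    have "(\<Sum>x\<in>X i. if P i x then t else 1) = (\<Sum>x\<in>X i. 1 + (if P i x then t - 1 else 0))"
      by (intro sum.cong) auto
    also have "\<dots> = real N + (t - 1) * real (card {x\<in>X i. P i x})"
      using X[OF i] N[OF i] by (simp add: sum.distrib sum.If_cases Int_def)
    also have "\<dots> = real N * (1 + (t - 1) * real (card {x\<in>X i. P i x}) / real N)"
      using \<open>0 < N\<close> by (simp add: field_simps)
    also have "\<dots> \<le> real N * exp ((t - 1) * real (card {x\<in>X i. P i x}) / real N)"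
      by (intro mult_left_mono exp_ge_add_one_self) auto
    finally show "(\<Sum>x\<in>X i. if P i x then t else 1)
        \<le> real N * exp ((t - 1) * real (card {x\<in>X i. P i x}) / real N)" .
  qed
  also have "\<dots> = real N ^ card I * exp ((t - 1) * (\<Sum>i\<in>I. real (card {x\<in>X i. P i x})) / real N)"
    using I by (simp add: prod.distrib exp_sum sum_distrib_left sum_divide_distrib)
  finally show ?thesis .
qed

text \<open>There are fewer than \<open>2 ^ (j + 1)\<close> bit strings of length at most
  \<open>j\<close>, prefix-free or not.\<close>

lemma card_short_le:
  fixes f :: "'a \<Rightarrow> bits"
  assumes T: "finite T" and B: "\<And>s. card {x\<in>T. f x = s} \<le> B"
  shows "card {x\<in>T. length (f x) \<le> j} \<le> 2 ^ (j + 1) * B"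
proof -
  let ?L = "{s::bits. set s \<subseteq> UNIV \<and> length s \<le> j}"
  have fin: "finite ?L" by (rule finite_lists_length_le) simp
  have "(\<Sum>i\<le>j. 2 ^ i) < (2::nat) ^ (j + 1)"
    by (induction j) auto
  then have L: "card ?L \<le> 2 ^ (j + 1)"
    by (subst card_lists_length_le) auto
  have "card {x\<in>T. length (f x) \<le> j} = card (\<Union>s\<in>?L. {x\<in>T. f x = s})"
    by (rule arg_cong[where f = card]) auto
  also have "\<dots> \<le> (\<Sum>s\<in>?L. card {x\<in>T. f x = s})"
    using fin by (rule card_UN_le)
  also have "\<dots> \<le> card ?L * B"
    using sum_bounded_above[of ?L "\<lambda>s. card {x\<in>T. f x = s}" B] B by simp
  also have "\<dots> \<le> 2 ^ (j + 1) * B"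
    using L by (rule mult_right_mono) simp
  finally show ?thesis .
qed

text \<open>Layer-cake summation: the truncated difference counts the \<open>j < N\<close> with
  \<open>length (f x) \<le> j\<close>, which leaves a geometric series. When
  \<open>2 ^ N * B\<close> is comparable to \<open>card T\<close>, lengths below \<open>N\<close>
  thus save only O(1) bits per element on average.\<close>

lemma sum_deficit_le:
  fixes f :: "'a \<Rightarrow> bits"
  assumes T: "finite T" and B: "\<And>s. card {x\<in>T. f x = s} \<le> B"
  shows "(\<Sum>x\<in>T. N - length (f x)) \<le> 2 * (2 ^ N * B)"
proof -
  have "N - length (f x) = (\<Sum>j<N. if length (f x) \<le> j then 1 else 0)" for x
  proof -
    have "{..<N} \<inter> {j. length (f x) \<le> j} = {length (f x)..<N}" by auto
    then show ?thesis by (simp add: sum.If_cases)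
  qed
  then have "(\<Sum>x\<in>T. N - length (f x)) = (\<Sum>x\<in>T. \<Sum>j<N. if length (f x) \<le> j then 1 else 0)"
    by (intro sum.cong refl)
  also have "\<dots> = (\<Sum>j<N. \<Sum>x\<in>T. if length (f x) \<le> j then 1 else 0)"
    by (rule sum.swap)
  also have "\<dots> = (\<Sum>j<N. card {x\<in>T. length (f x) \<le> j})"
    using T by (simp add: sum.If_cases Int_def)
  also have "\<dots> \<le> (\<Sum>j<N. 2 ^ (j + 1) * B)"
    by (intro sum_mono card_short_le T B)
  also have "\<dots> = (\<Sum>j<N. 2 ^ j) * 2 * B"
    unfolding sum_distrib_right by (intro sum.cong) auto
  also have "(\<Sum>j<N. 2 ^ j) \<le> (2::nat) ^ N"
    by (induction N) auto
  finally show ?thesis by (simp add: mult_ac)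
qed

lemma card_PiE_component:
  assumes I: "finite I" and i: "i \<in> I" and "Y \<subseteq> X i"
  shows "card {c \<in> PiE I X. c i \<in> Y} * card (X i) = card Y * card (PiE I X)"
proof -
  have "{c \<in> PiE I X. c i \<in> Y} = PiE I (X(i := Y))"
  proof (rule set_eqI)
    fix c
    have "(\<forall>j\<in>I. c j \<in> (X(i := Y)) j) \<longleftrightarrow> (\<forall>j\<in>I. c j \<in> X j) \<and> c i \<in> Y"
      using i \<open>Y \<subseteq> X i\<close> by (metis fun_upd_apply subsetD)
    then show "c \<in> {c \<in> PiE I X. c i \<in> Y} \<longleftrightarrow> c \<in> PiE I (X(i := Y))"
      unfolding PiE_iff mem_Collect_eq by blast
  qed
  then have "card {c \<in> PiE I X. c i \<in> Y} = (\<Prod>j\<in>I. card ((X(i := Y)) j))"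
    using I by (simp add: card_PiE)
  also have "\<dots> = card Y * (\<Prod>j\<in>I-{i}. card (X j))"
    using I i by (subst prod.remove[of _ i]) (auto intro!: prod.cong)
  finally have "card {c \<in> PiE I X. c i \<in> Y} = card Y * (\<Prod>j\<in>I-{i}. card (X j))" .
  moreover have "card (PiE I X) = card (X i) * (\<Prod>j\<in>I-{i}. card (X j))"
    using I i by (simp add: card_PiE prod.remove)
  ultimately show ?thesis by simp
qed

section \<open>Random operation sequences\<close>

definition vals :: "nat \<Rightarrow> bits set" where
  "vals v = {f. length f = v}"

lemma finite_vals [simp]: "finite (vals v)"
  using finite_lists_length_eq[of "UNIV :: bool set" v] by (simp add: vals_def)

lemma card_vals [simp]: "card (vals v) = 2 ^ v"
  using card_lists_length_eq[of "UNIV :: bool set" v] by (simp add: vals_def)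

text \<open>A pair \<open>(d, \<gamma>)\<close> of the first phase stores key \<open>fst (d i)\<close> of block \<open>i\<close> with value \<open>snd (d i)\<close>, and
  the \<open>j\<close>-th fixed key with value \<open>\<gamma> j\<close>.\<close>

definition first_phase :: "nat \<Rightarrow> nat \<Rightarrow> nat \<Rightarrow> nat \<Rightarrow> ((nat \<Rightarrow> nat \<times> bits) \<times> (nat \<Rightarrow> bits)) set" where
  "first_phase m p q v = PiE {..<m} (\<lambda>_. {..<q} \<times> vals v) \<times> PiE {..<p} (\<lambda>_. vals v)"

definition second_phase :: "nat \<Rightarrow> nat \<Rightarrow> nat \<Rightarrow> (nat \<Rightarrow> nat \<times> bits) set" where
  "second_phase p q v = PiE {..<p} (\<lambda>_. {..<q} \<times> vals v)"

text \<open>Keys of different blocks are always distinct, so a key common to both phases can only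
  arise within one block.\<close>

definition conflict :: "nat \<Rightarrow> (nat \<Rightarrow> nat \<times> bits) \<Rightarrow> (nat \<Rightarrow> nat \<times> bits) \<Rightarrow> bool" where
  "conflict m d c \<longleftrightarrow> (\<exists>i<m. fst (d i) = fst (c i))"

text \<open>Conflicting pairs are left out because inserting a stored key is not admissible.\<close>

definition phases where
  "phases m p q v = {(\<omega>, c). \<omega> \<in> first_phase m p q v \<and> c \<in> second_phase p q v \<and> \<not> conflict m (fst \<omega>) c}"

lemma finite_first_phase [simp]: "finite (first_phase m p q v)"
  by (simp add: first_phase_def finite_PiE)

lemma finite_second_phase [simp]: "finite (second_phase p q v)"
  by (simp add: second_phase_def finite_PiE)

lemma finite_phases [simp]: "finite (phases m p q v)"
  by (rule finite_subset[of _ "first_phase m p q v \<times> second_phase p q v"]) (auto simp: phases_def)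

lemma card_first_phase: "card (first_phase m p q v) = q ^ m * 2 ^ ((m + p) * v)"
  by (simp add: first_phase_def card_cartesian_product card_PiE power_mult_distrib
      mult.commute[of _ v] distrib_left power_add flip: power_mult)

lemma card_second_phase: "card (second_phase p q v) = q ^ p * 2 ^ (p * v)"
  by (simp add: second_phase_def card_cartesian_product card_PiE power_mult_distrib
      mult.commute[of _ v] flip: power_mult)

text \<open>Union bound over the \<open>m\<close> blocks: in each one the uniform key of
  \<open>c\<close> hits the given key with probability at most \<open>1 / q\<close>.\<close>

lemma card_conflict_le:
  assumes "m \<le> p" "0 < q"
  shows "card {c \<in> second_phase p q v. conflict m d c} * q \<le> m * card (second_phase p q v)"
proof -
  \<comment> \<open>\<open>d\<close> is arbitrary, so \<open>fst (d i)\<close> may lie outside the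
    block; the intersection keeps \<open>?Y i\<close> inside the range of
    \<open>c i\<close>.\<close>
  let ?Y = "\<lambda>i. ({fst (d i)} \<inter> {..<q}) \<times> vals v"
  have one: "card {c \<in> second_phase p q v. c i \<in> ?Y i} * q \<le> card (second_phase p q v)"
    if i: "i < m" for i
  proof -
    have "card {c \<in> second_phase p q v. c i \<in> ?Y i} * card ({..<q} \<times> vals v)
        = card (?Y i) * card (second_phase p q v)"
      unfolding second_phase_def using i \<open>m \<le> p\<close>
      by (intro card_PiE_component) auto
    moreover have "card ({fst (d i)} \<inter> {..<q}) \<le> 1"
      by (rule order_trans[OF card_mono[of "{fst (d i)}"]]) auto
    then have "card (?Y i) \<le> 2 ^ v"
      by (simp add: card_cartesian_product)
    ultimately have "card {c \<in> second_phase p q v. c i \<in> ?Y i} * (q * 2 ^ v)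
        \<le> 2 ^ v * card (second_phase p q v)"
      by (simp add: card_cartesian_product)
    then have "2 ^ v * (card {c \<in> second_phase p q v. c i \<in> ?Y i} * q)
        \<le> 2 ^ v * card (second_phase p q v)"
      by (simp add: mult_ac)
    then show ?thesis by simp
  qed
  have "{c \<in> second_phase p q v. conflict m d c} \<subseteq> (\<Union>i<m. {c \<in> second_phase p q v. c i \<in> ?Y i})"
  proof safe
    fix c assume c: "c \<in> second_phase p q v" "conflict m d c"
    then obtain i where i: "i < m" "fst (d i) = fst (c i)" by (auto simp: conflict_def)
    have "c i \<in> {..<q} \<times> vals v"
      using c i \<open>m \<le> p\<close> by (auto simp: second_phase_def PiE_iff)
    then show "c \<in> (\<Union>i<m. {c \<in> second_phase p q v. c i \<in> ?Y i})"
      using c i by (intro UN_I[of i]) (auto simp: mem_Times_iff)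
  qed
  then have "card {c \<in> second_phase p q v. conflict m d c}
      \<le> card (\<Union>i<m. {c \<in> second_phase p q v. c i \<in> ?Y i})"
    by (intro card_mono) auto
  also have "\<dots> \<le> (\<Sum>i<m. card {c \<in> second_phase p q v. c i \<in> ?Y i})"
    by (rule card_UN_le) simp
  finally have "card {c \<in> second_phase p q v. conflict m d c} * q
      \<le> (\<Sum>i<m. card {c \<in> second_phase p q v. c i \<in> ?Y i} * q)"
    by (simp add: sum_distrib_right[symmetric])
  also have "\<dots> \<le> (\<Sum>i<m. card (second_phase p q v))"
    by (intro sum_mono one) simp
  finally show ?thesis by simp
qed

lemma card_phases_ge:
  assumes "m \<le> p" "0 < m" "64 * m \<le> q"
  shows "63 * (card (first_phase m p q v) * card (second_phase p q v)) \<le> 64 * card (phases m p q v)"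
proof -
  let ?C = "SIGMA \<omega> : first_phase m p q v. {c \<in> second_phase p q v. conflict m (fst \<omega>) c}"
  have "first_phase m p q v \<times> second_phase p q v = phases m p q v \<union> ?C"
    by (auto simp: phases_def)
  then have "card (first_phase m p q v \<times> second_phase p q v) = card (phases m p q v) + card ?C"
    by (simp only:) (subst card_Un_disjoint, simp_all, auto simp: phases_def)
  moreover have "card ?C * 64 \<le> card (first_phase m p q v) * card (second_phase p q v)"
  proof -
    have "card ?C * q = (\<Sum>\<omega>\<in>first_phase m p q v. card {c \<in> second_phase p q v. conflict m (fst \<omega>) c} * q)"
      by (simp add: card_SigmaI sum_distrib_right)
    also have "\<dots> \<le> (\<Sum>\<omega>\<in>first_phase m p q v. m * card (second_phase p q v))"
      using assms by (intro sum_mono card_conflict_le) auto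
    finally have "card ?C * q \<le> m * (card (first_phase m p q v) * card (second_phase p q v))"
      by (simp add: mult_ac)
    moreover have "card ?C * (64 * m) \<le> card ?C * q"
      using assms by simp
    ultimately have "m * (card ?C * 64) \<le> m * (card (first_phase m p q v) * card (second_phase p q v))"
      by (simp only: mult_ac)
    then show ?thesis using \<open>0 < m\<close> by simp
  qed
  ultimately show ?thesis by (simp add: card_cartesian_product)
qed

section \<open>The counting argument for a fixed tape\<close>

text \<open>\<open>s1\<close> is the state after the first phase and \<open>F s c\<close> the state reached from \<open>s\<close> by the second
  phase. The answers for key \<open>x\<close> of block \<open>i\<close> after the two phases are given by \<open>g1\<close> and \<open>g2\<close>, those
  for the fixed keys by \<open>gc\<close>.\<close>

locale two_phase =
  fixes m p q v :: nat
    and s1 :: "(nat \<Rightarrow> nat \<times> bits) \<times> (nat \<Rightarrow> bits) \<Rightarrow> bits"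
    and F :: "bits \<Rightarrow> (nat \<Rightarrow> nat \<times> bits) \<Rightarrow> bits"
    and g1 g2 :: "bits \<Rightarrow> nat \<Rightarrow> nat \<Rightarrow> bits"
    and gc :: "bits \<Rightarrow> nat \<Rightarrow> bits"
  assumes m: "0 < m" "m \<le> p" and q: "64 * m \<le> q" "4 * m * m \<le> q" and v: "1 \<le> v"
    and g1: "\<And>\<omega> i. \<omega> \<in> first_phase m p q v \<Longrightarrow> i < m \<Longrightarrow> g1 (s1 \<omega>) i (fst (fst \<omega> i)) = snd (fst \<omega> i)"
    and gc: "\<And>\<omega> i. \<omega> \<in> first_phase m p q v \<Longrightarrow> i < p \<Longrightarrow> gc (s1 \<omega>) i = snd \<omega> i"
    and g2_old: "\<And>\<omega> c i. (\<omega>, c) \<in> phases m p q v \<Longrightarrow> i < m \<Longrightarrow>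
      g2 (F (s1 \<omega>) c) i (fst (fst \<omega> i)) = snd (fst \<omega> i)"
    and g2_new: "\<And>\<omega> c i. (\<omega>, c) \<in> phases m p q v \<Longrightarrow> i < p \<Longrightarrow>
      g2 (F (s1 \<omega>) c) i (fst (c i)) = snd (c i)"
begin

abbreviation "\<Omega>1 \<equiv> first_phase m p q v"
abbreviation "\<Omega>2 \<equiv> second_phase p q v"
abbreviation "T \<equiv> phases m p q v"
abbreviation "s2 \<tau> \<equiv> F (s1 (fst \<tau>)) (snd \<tau>)"
abbreviation "N \<equiv> (m + p) * v"

section \<open>Candidate keys and answers attached to a state\<close>

definition graph_on :: "(nat \<Rightarrow> nat \<Rightarrow> bits) \<Rightarrow> nat \<Rightarrow> nat set \<Rightarrow> (nat \<times> bits) set" where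
  "graph_on g i W = (\<lambda>x. (x, g i x)) ` W"

definition pre :: "bits \<Rightarrow> ((nat \<Rightarrow> nat \<times> bits) \<times> (nat \<Rightarrow> bits)) set" where
  "pre s = {\<omega> \<in> \<Omega>1. s1 \<omega> = s}"

definition W :: "bits \<Rightarrow> nat \<Rightarrow> nat set" where
  "W s i = (\<lambda>\<omega>. fst (fst \<omega> i)) ` pre s"

definition wit :: "bits \<Rightarrow> nat \<Rightarrow> nat \<Rightarrow> (nat \<Rightarrow> nat \<times> bits) \<times> (nat \<Rightarrow> bits)" where
  "wit s i x = (SOME \<omega>. \<omega> \<in> pre s \<and> fst (fst \<omega> i) = x)"

text \<open>Outside this set, the first phase \<open>wit s i x\<close> shows that \<open>F s c\<close> must answer \<open>x\<close> like \<open>s\<close>.\<close>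

definition Bad :: "bits \<Rightarrow> (nat \<Rightarrow> nat \<times> bits) \<Rightarrow> nat \<Rightarrow> nat set" where
  "Bad s c i = {x \<in> W s i. conflict m (fst (wit s i x)) c}"

text \<open>For \<open>i \<ge> m\<close> the first phase stores no key in block \<open>i\<close> and
  \<open>W s i\<close> is meaningless; the condition \<open>i < m\<close> excludes these
  blocks.\<close>

definition changed :: "bits \<Rightarrow> nat \<Rightarrow> nat \<times> bits \<Rightarrow> bool" where
  "changed s i z \<longleftrightarrow> i < m \<and> fst z \<in> W s i \<and> snd z \<noteq> g1 s i (fst z)"

lemma q_pos: "0 < q"
  using m q by simp

lemma card_graph_on [simp]: "card (graph_on g i X) = card X"
  unfolding graph_on_def by (rule card_image) (auto simp: inj_on_def)

lemma finite_graph_on [simp]: "finite X \<Longrightarrow> finite (graph_on g i X)"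
  by (simp add: graph_on_def)

lemma finite_pre [simp]: "finite (pre s)"
  by (simp add: pre_def)

lemma W_subset: "i < m \<Longrightarrow> W s i \<subseteq> {..<q}"
  by (auto simp: W_def pre_def first_phase_def PiE_iff mem_Times_iff)

lemma finite_W [simp]: "finite (W s i)"
  by (simp add: W_def)

lemma wit:
  assumes "x \<in> W s i"
  shows "wit s i x \<in> pre s" "fst (fst (wit s i x) i) = x"
proof -
  have "\<exists>\<omega>. \<omega> \<in> pre s \<and> fst (fst \<omega> i) = x"
    using assms by (auto simp: W_def)
  then have "wit s i x \<in> pre s \<and> fst (fst (wit s i x) i) = x"
    unfolding wit_def by (rule someI_ex)
  then show "wit s i x \<in> pre s" "fst (fst (wit s i x) i) = x" by auto
qed

text \<open>The state \<open>s\<close> dictates the values of all keys of \<open>A\<close> and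
  \<open>C\<close>, so a preimage is determined by its keys, and its key in block \<open>i\<close>
  lies in \<open>W s i\<close>.\<close>

lemma card_pre_le: "card (pre s) \<le> (\<Prod>i<m. card (W s i))"
proof -
  have "pre s \<subseteq> PiE {..<m} (\<lambda>i. graph_on (g1 s) i (W s i)) \<times> {restrict (gc s) {..<p}}"
  proof
    fix \<omega> assume \<omega>: "\<omega> \<in> pre s"
    then have \<omega>': "\<omega> \<in> \<Omega>1" "s1 \<omega> = s" by (auto simp: pre_def)
    have "fst \<omega> \<in> PiE {..<m} (\<lambda>i. graph_on (g1 s) i (W s i))"
    proof (rule PiE_I)
      fix i assume "i \<in> {..<m}"
      then have "fst \<omega> i = (fst (fst \<omega> i), g1 s i (fst (fst \<omega> i)))"
        using g1[OF \<omega>'(1), of i] \<omega>'(2) by (simp add: prod_eq_iff)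
      moreover have "fst (fst \<omega> i) \<in> W s i" using \<omega> by (auto simp: W_def)
      ultimately show "fst \<omega> i \<in> graph_on (g1 s) i (W s i)"
        unfolding graph_on_def by blast
    next
      fix i assume "i \<notin> {..<m}"
      then show "fst \<omega> i = undefined" using \<omega>'(1) by (auto simp: first_phase_def)
    qed
    moreover have "snd \<omega> = restrict (gc s) {..<p}"
      using \<omega>'(1) gc[OF \<omega>'(1)] \<omega>'(2)
      by (auto simp: first_phase_def PiE_iff extensional_def fun_eq_iff)
    ultimately show "\<omega> \<in> PiE {..<m} (\<lambda>i. graph_on (g1 s) i (W s i)) \<times> {restrict (gc s) {..<p}}"
      by (simp add: mem_Times_iff)
  qed
  then have "card (pre s) \<le> card (PiE {..<m} (\<lambda>i. graph_on (g1 s) i (W s i)) \<times> {restrict (gc s) {..<p}})"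
    by (intro card_mono) (auto intro!: finite_PiE)
  then show ?thesis by (simp add: card_cartesian_product card_PiE)
qed

lemma card_pre_le_power: "card (pre s) \<le> q ^ m"
proof -
  have "(\<Prod>i<m. card (W s i)) \<le> (\<Prod>i<m. q)"
    using card_mono[OF _ W_subset] by (intro prod_mono) auto
  then show ?thesis using card_pre_le[of s] by simp
qed

lemma card_fiber1_le: "card {\<tau> \<in> T. s1 (fst \<tau>) = s} \<le> q ^ m * card \<Omega>2"
proof -
  have "card {\<tau> \<in> T. s1 (fst \<tau>) = s} \<le> card (pre s \<times> \<Omega>2)"
    by (intro card_mono) (auto simp: phases_def pre_def)
  also have "\<dots> \<le> q ^ m * card \<Omega>2"
    using card_pre_le_power by (simp add: card_cartesian_product)
  finally show ?thesis .
qed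

lemma old_in_graph:
  assumes "(\<omega>, c) \<in> T"
  shows "\<omega> \<in> PiE {..<m} (\<lambda>i. graph_on (g2 (F (s1 \<omega>) c)) i {..<q}) \<times> PiE {..<p} (\<lambda>_. vals v)"
proof -
  have \<omega>: "\<omega> \<in> \<Omega>1" using assms by (auto simp: phases_def)
  have "fst \<omega> \<in> PiE {..<m} (\<lambda>i. graph_on (g2 (F (s1 \<omega>) c)) i {..<q})"
  proof (rule PiE_I)
    fix i assume i: "i \<in> {..<m}"
    then have "fst \<omega> i = (fst (fst \<omega> i), g2 (F (s1 \<omega>) c) i (fst (fst \<omega> i)))"
      using g2_old[OF assms, of i] by (simp add: prod_eq_iff)
    moreover have "fst (fst \<omega> i) \<in> {..<q}"
      using \<omega> i by (auto simp: first_phase_def PiE_iff mem_Times_iff)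
    ultimately show "fst \<omega> i \<in> graph_on (g2 (F (s1 \<omega>) c)) i {..<q}"
      unfolding graph_on_def by blast
  next
    fix i assume "i \<notin> {..<m}"
    then show "fst \<omega> i = undefined" using \<omega> by (auto simp: first_phase_def)
  qed
  then show ?thesis using \<omega> by (auto simp: first_phase_def)
qed

lemma new_in_graph:
  assumes "(\<omega>, c) \<in> T"
  shows "c \<in> PiE {..<p} (\<lambda>i. graph_on (g2 (F (s1 \<omega>) c)) i {..<q})"
proof (rule PiE_I)
  fix i assume i: "i \<in> {..<p}"
  then have "c i = (fst (c i), g2 (F (s1 \<omega>) c) i (fst (c i)))"
    using g2_new[OF assms, of i] by (simp add: prod_eq_iff)
  moreover have "fst (c i) \<in> {..<q}"
    using assms i by (auto simp: phases_def second_phase_def PiE_iff mem_Times_iff)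
  ultimately show "c i \<in> graph_on (g2 (F (s1 \<omega>) c)) i {..<q}"
    unfolding graph_on_def by blast
next
  fix i assume "i \<notin> {..<p}"
  then show "c i = undefined" using assms by (auto simp: phases_def second_phase_def)
qed

lemma card_old_graph:
  "card (PiE {..<m} (\<lambda>i. graph_on g i {..<q}) \<times> PiE {..<p} (\<lambda>_. vals v)) = q ^ m * 2 ^ (p * v)"
  by (simp add: card_cartesian_product card_PiE mult.commute[of _ v] flip: power_mult)

lemma finite_old_graph:
  "finite (PiE {..<m} (\<lambda>i. graph_on g i {..<q}) \<times> PiE {..<p} (\<lambda>_. vals v))"
  by (auto intro!: finite_PiE)

text \<open>The final state dictates the values of \<open>A\<close> and \<open>B\<close> but not
  those of the deleted keys \<open>C\<close>, hence the factor \<open>2 ^ (p * v)\<close>. As in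
  \<open>card_fiber1_le\<close>, the bound is \<open>card \<Omega>1 * card \<Omega>2\<close> divided
  by \<open>2 ^ N\<close>.\<close>

lemma card_fiber2_le: "card {\<tau> \<in> T. s2 \<tau> = s} \<le> q ^ m * 2 ^ (p * v) * q ^ p"
proof -
  let ?A = "PiE {..<m} (\<lambda>i. graph_on (g2 s) i {..<q}) \<times> PiE {..<p} (\<lambda>_. vals v)"
  let ?B = "PiE {..<p} (\<lambda>i. graph_on (g2 s) i {..<q})"
  have "{\<tau> \<in> T. s2 \<tau> = s} \<subseteq> ?A \<times> ?B"
    using old_in_graph new_in_graph by fastforce
  moreover have "finite (?A \<times> ?B)"
    by (intro finite_cartesian_product finite_PiE) auto
  ultimately have "card {\<tau> \<in> T. s2 \<tau> = s} \<le> card (?A \<times> ?B)"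
    by (intro card_mono)
  also have "\<dots> = q ^ m * 2 ^ (p * v) * q ^ p"
    unfolding card_cartesian_product[of ?A] card_old_graph by (simp add: card_PiE)
  finally show ?thesis .
qed

section \<open>Exceptional events for a random second phase\<close>

text \<open>A key is bad with probability at most \<open>m / q\<close>, as its witness must
  conflict. With at most \<open>m * q\<close> candidate keys, the expected number of bad ones is at
  most \<open>m * m \<le> q / 4\<close>, and Markov's inequality at \<open>8 * q\<close> gives
  \<open>1 / 32\<close>.\<close>

lemma card_bad_le: "32 * card {c \<in> \<Omega>2. 8 * q < (\<Sum>i<m. card (Bad s c i))} \<le> card \<Omega>2"
proof -
  let ?X = "{c \<in> \<Omega>2. 8 * q < (\<Sum>i<m. card (Bad s c i))}"
  have "card ?X * (8 * q) \<le> (\<Sum>c\<in>?X. \<Sum>i<m. card (Bad s c i))"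
    using sum_mono[of ?X "\<lambda>_. 8 * q" "\<lambda>c. \<Sum>i<m. card (Bad s c i)"] by simp
  also have "\<dots> \<le> (\<Sum>c\<in>\<Omega>2. \<Sum>i<m. card (Bad s c i))"
    by (intro sum_mono2) auto
  also have "\<dots> = (\<Sum>i<m. \<Sum>c\<in>\<Omega>2. card (Bad s c i))"
    by (rule sum.swap)
  also have "\<dots> = (\<Sum>i<m. \<Sum>x\<in>W s i. card {c \<in> \<Omega>2. conflict m (fst (wit s i x)) c})"
    unfolding Bad_def by (intro sum.cong refl sum_multicount_gen) auto
  finally have "card ?X * (8 * q) * q
      \<le> (\<Sum>i<m. \<Sum>x\<in>W s i. card {c \<in> \<Omega>2. conflict m (fst (wit s i x)) c}) * q"
    by (rule mult_right_mono) simp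
  also have "\<dots> = (\<Sum>i<m. \<Sum>x\<in>W s i. card {c \<in> \<Omega>2. conflict m (fst (wit s i x)) c} * q)"
    by (simp add: sum_distrib_right)
  also have "\<dots> \<le> (\<Sum>i<m. \<Sum>x\<in>W s i. m * card \<Omega>2)"
    using m q_pos by (intro sum_mono card_conflict_le) auto
  also have "\<dots> = (\<Sum>i<m. card (W s i)) * (m * card \<Omega>2)"
    by (simp add: sum_distrib_right)
  also have "\<dots> \<le> (\<Sum>i<m. q) * (m * card \<Omega>2)"
    using card_mono[OF _ W_subset] by (intro mult_right_mono sum_mono) auto
  finally have "q * (8 * q * card ?X) \<le> q * (m * m * card \<Omega>2)"
    by (simp add: mult_ac)
  then have "8 * q * card ?X \<le> m * m * card \<Omega>2"
    using q_pos by simp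
  then have "q * (32 * card ?X) \<le> (4 * m * m) * card \<Omega>2"
    by (simp add: mult_ac)
  also have "\<dots> \<le> q * card \<Omega>2"
    using q by (intro mult_right_mono) auto
  finally show ?thesis using q_pos by simp
qed

text \<open>Each preimage conflicts with probability at most \<open>m / q \<le> 1 / 64\<close>;
  Markov's inequality then gives \<open>1 / 32\<close> for more than half of them
  conflicting.\<close>

lemma card_half_conflict_le:
  assumes "pre s \<noteq> {}"
  shows "32 * card {c \<in> \<Omega>2. card (pre s) < 2 * card {\<omega> \<in> pre s. conflict m (fst \<omega>) c}} \<le> card \<Omega>2"
proof -
  let ?X = "{c \<in> \<Omega>2. card (pre s) < 2 * card {\<omega> \<in> pre s. conflict m (fst \<omega>) c}}"
  have "card ?X * card (pre s) \<le> (\<Sum>c\<in>?X. 2 * card {\<omega> \<in> pre s. conflict m (fst \<omega>) c})"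
    using sum_mono[of ?X "\<lambda>_. card (pre s)" "\<lambda>c. 2 * card {\<omega> \<in> pre s. conflict m (fst \<omega>) c}"] by simp
  also have "\<dots> \<le> (\<Sum>c\<in>\<Omega>2. 2 * card {\<omega> \<in> pre s. conflict m (fst \<omega>) c})"
    by (intro sum_mono2) auto
  also have "\<dots> = 2 * (\<Sum>\<omega>\<in>pre s. card {c \<in> \<Omega>2. conflict m (fst \<omega>) c})"
    unfolding sum_distrib_left[symmetric]
    by (intro arg_cong[where f = "(*) 2"] sum_multicount_gen) auto
  finally have "card ?X * card (pre s) * q
      \<le> 2 * (\<Sum>\<omega>\<in>pre s. card {c \<in> \<Omega>2. conflict m (fst \<omega>) c}) * q"
    by (rule mult_right_mono) simp
  also have "\<dots> = 2 * (\<Sum>\<omega>\<in>pre s. card {c \<in> \<Omega>2. conflict m (fst \<omega>) c} * q)"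
    by (simp add: sum_distrib_right)
  also have "\<dots> \<le> 2 * (\<Sum>\<omega>\<in>pre s. m * card \<Omega>2)"
    using m q_pos by (intro mult_left_mono sum_mono card_conflict_le) auto
  finally have "card (pre s) * (card ?X * q) \<le> card (pre s) * (2 * m * card \<Omega>2)"
    by (simp add: mult_ac)
  moreover have "0 < card (pre s)" using assms by (simp add: card_gt_0_iff)
  ultimately have "card ?X * q \<le> 2 * m * card \<Omega>2" by simp
  moreover have "card ?X * (64 * m) \<le> card ?X * q"
    using q by simp
  ultimately have "card ?X * (64 * m) \<le> 2 * m * card \<Omega>2" by linarith
  then have "m * (64 * card ?X) \<le> m * (2 * card \<Omega>2)"
    by (simp only: mult_ac)
  then have "64 * card ?X \<le> 2 * card \<Omega>2" using m by (simp only: mult_le_cancel1)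
  then show ?thesis by simp
qed

text \<open>The densities \<open>card (W s i) / q\<close> have product at least
  \<open>2 powr (- r)\<close>, and their arithmetic mean is at least the geometric one.\<close>

lemma sum_card_W_ge:
  assumes "q ^ m \<le> 2 ^ r * card (pre s)"
  shows "real m * 2 powr (- (real r / real m)) \<le> (\<Sum>i<m. real (card (W s i)) / real q)"
proof -
  let ?x = "\<lambda>i. real (card (W s i)) / real q"
  have "real (q ^ m) \<le> 2 ^ r * real (card (pre s))"
    using assms by (simp only: of_nat_le_iff flip: of_nat_mult of_nat_power of_nat_numeral[where ?'a = real])
  also have "\<dots> \<le> 2 ^ r * real (\<Prod>i<m. card (W s i))"
    using card_pre_le[of s] by (intro mult_left_mono) (simp_all only: of_nat_le_iff, simp)
  finally have "2 powr (- real r) \<le> (\<Prod>i<m. ?x i)"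
    using q_pos by (simp add: prod_dividef powr_minus powr_realpow divide_simps) (simp add: mult.commute)
  then have "(2 powr (- real r)) powr (1 / real m) \<le> (\<Prod>i<m. ?x i) powr (1 / real m)"
    by (intro powr_mono2) auto
  also have "\<dots> \<le> (\<Sum>i<m. ?x i / real m)"
    using arith_geom_mean[of "{..<m}" ?x] m by (simp add: lessThan_empty_iff)
  finally have "2 powr (- (real r / real m)) \<le> (\<Sum>i<m. ?x i) / real m"
    by (simp add: powr_powr sum_divide_distrib)
  then show ?thesis
    using m by (simp add: pos_le_divide_eq mult.commute)
qed

text \<open>A uniform value differs from the old one with probability \<open>1 - 1 / 2 ^ v\<close>,
  which is at least \<open>1 / 2\<close> because \<open>1 \<le> v\<close>.\<close>

lemma card_changed_ge:
  assumes i: "i < m"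
  shows "card (W s i) * 2 ^ v \<le> 2 * card {z \<in> {..<q} \<times> vals v. changed s i z}"
proof -
  have eq: "{z \<in> {..<q} \<times> vals v. changed s i z} = (SIGMA x : W s i. vals v - {g1 s i x})"
    using i W_subset[OF i, of s] by (auto simp: changed_def)
  have "card (W s i) * (2 ^ v - 1) = (\<Sum>x\<in>W s i. 2 ^ v - 1)"
    by simp
  also have "\<dots> \<le> (\<Sum>x\<in>W s i. card (vals v - {g1 s i x}))"
  proof (rule sum_mono)
    fix x
    show "2 ^ v - 1 \<le> card (vals v - {g1 s i x})"
      using diff_card_le_card_Diff[of "{g1 s i x}" "vals v"] by simp
  qed
  also have "\<dots> = card {z \<in> {..<q} \<times> vals v. changed s i z}"
    unfolding eq by (simp add: card_SigmaI)
  finally have "2 * (card (W s i) * (2 ^ v - 1)) \<le> 2 * card {z \<in> {..<q} \<times> vals v. changed s i z}"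
    by simp
  moreover have "(2::nat) ^ v \<le> 2 * (2 ^ v - 1)"
    using power_increasing[OF v, of "2::nat"] by simp
  then have "card (W s i) * 2 ^ v \<le> card (W s i) * (2 * (2 ^ v - 1))"
    by (rule mult_left_mono) simp
  moreover have "card (W s i) * (2 * (2 ^ v - 1)) = 2 * (card (W s i) * (2 ^ v - 1))"
    by (simp only: mult_ac)
  ultimately show ?thesis by linarith
qed

text \<open>Chernoff bound: the expected number of changed coordinates is at least
  \<open>\<mu> / 2\<close>, so the probability of fewer than \<open>h\<close> is at most
  \<open>2 ^ h * exp (- (\<mu> / 4))\<close>. This is below \<open>exp (- 4)\<close> or equal to it
  since \<open>h \<le> \<mu> / 8\<close> and \<open>32 \<le> \<mu>\<close>.\<close>

lemma card_few_changed_le: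
  assumes pre: "q ^ m \<le> 2 ^ r * card (pre s)"
    and h: "8 * real h \<le> real m * 2 powr (- (real r / real m))"
    and h2: "32 \<le> real m * 2 powr (- (real r / real m))"
  shows "32 * card {c \<in> \<Omega>2. card {i \<in> {..<p}. changed s i (c i)} < h} \<le> card \<Omega>2"
proof -
  define \<mu> where "\<mu> = real m * 2 powr (- (real r / real m))"
  let ?X = "{c \<in> \<Omega>2. card {i \<in> {..<p}. changed s i (c i)} < h}"
  let ?S = "\<Sum>i<p. real (card {z \<in> {..<q} \<times> vals v. changed s i z})"
  have "\<mu> \<le> (\<Sum>i<m. real (card (W s i)) / real q)"
    unfolding \<mu>_def by (rule sum_card_W_ge[OF pre])
  also have "\<dots> \<le> (\<Sum>i<m. 2 * real (card {z \<in> {..<q} \<times> vals v. changed s i z}) / real (q * 2 ^ v))"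
  proof (intro sum_mono)
    fix i assume "i \<in> {..<m}"
    then have "card (W s i) * 2 ^ v \<le> 2 * card {z \<in> {..<q} \<times> vals v. changed s i z}"
      using card_changed_ge by simp
    then have "real (card (W s i)) * 2 ^ v \<le> 2 * real (card {z \<in> {..<q} \<times> vals v. changed s i z})"
      by (simp only: of_nat_le_iff flip: of_nat_mult of_nat_power of_nat_numeral[where ?'a = real])
    then show "real (card (W s i)) / real q
        \<le> 2 * real (card {z \<in> {..<q} \<times> vals v. changed s i z}) / real (q * 2 ^ v)"
      using q_pos by (simp add: field_simps)
  qed
  also have "\<dots> \<le> (\<Sum>i<p. 2 * real (card {z \<in> {..<q} \<times> vals v. changed s i z}) / real (q * 2 ^ v))"
    using m by (intro sum_mono2) auto
  also have "\<dots> = 2 * ?S / real (q * 2 ^ v)"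
    by (simp add: sum_divide_distrib sum_distrib_left)
  finally have S: "\<mu> / 2 \<le> ?S / real (q * 2 ^ v)" by (simp add: mult.commute)
  have "(1 / 2) ^ h * real (card ?X) = (\<Sum>c\<in>?X. (1 / 2 :: real) ^ h)" by simp
  also have "\<dots> \<le> (\<Sum>c\<in>?X. (1 / 2) ^ card {i \<in> {..<p}. changed s i (c i)})"
    by (intro sum_mono power_decreasing) auto
  also have "\<dots> \<le> (\<Sum>c\<in>\<Omega>2. (1 / 2) ^ card {i \<in> {..<p}. changed s i (c i)})"
    by (intro sum_mono2) auto
  also have "\<dots> \<le> real (q * 2 ^ v) ^ card {..<p} * exp ((1 / 2 - 1) * ?S / real (q * 2 ^ v))"
    unfolding second_phase_def using q_pos
    by (intro sum_power_card_PiE_le) (auto simp: card_cartesian_product)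
  also have "\<dots> = real (card \<Omega>2) * exp (- (1 / 2) * (?S / real (q * 2 ^ v)))"
    by (simp add: card_second_phase power_mult_distrib mult.commute[of p v] flip: power_mult)
  also have "\<dots> \<le> real (card \<Omega>2) * exp (- (1 / 2) * (\<mu> / 2))"
    using S by (intro mult_left_mono) (auto simp: mult.commute)
  finally have "(1 / 2) ^ h * real (card ?X) \<le> real (card \<Omega>2) * exp (- (\<mu> / 4))" by simp
  then have "real (card ?X) \<le> real (card \<Omega>2) * (2 ^ h * exp (- (\<mu> / 4)))"
    by (simp add: power_one_over field_simps)
  also have "\<dots> \<le> real (card \<Omega>2) * (1 / 32)"
  proof (rule mult_left_mono)
    have "(2::real) \<le> exp 1" using exp_ge_add_one_self[of 1] by simp
    then have "2 ^ h \<le> exp (1::real) ^ h" by (rule power_mono) simp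
    also have "\<dots> = exp (real h)" using exp_of_nat_mult[of h "1::real"] by simp
    finally have "2 ^ h * exp (- (\<mu> / 4)) \<le> exp (real h) * exp (- (\<mu> / 4))"
      by (rule mult_right_mono) simp
    also have "\<dots> \<le> exp (- 4)"
      using h h2 unfolding exp_add[symmetric] \<mu>_def[symmetric] by simp
    also have "\<dots> \<le> 1 / 32"
    proof -
      \<comment> \<open>The estimate \<open>exp 1 \<ge> 2\<close> would only give 16 here, short of
        the required 32.\<close>
      have "(5 / 2 :: real) \<le> exp 1" using exp_lower_Taylor_quadratic[of 1] by simp
      then have "(5 / 2 :: real) ^ 4 \<le> exp 1 ^ 4" by (rule power_mono) simp
      also have "\<dots> = exp 4" using exp_of_nat_mult[of 4 "1::real"] by simp
      finally have "32 \<le> exp (4::real)" by (simp add: power_divide)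
      then show ?thesis by (simp add: exp_minus field_simps)
    qed
    finally show "2 ^ h * exp (- (\<mu> / 4)) \<le> 1 / 32" .
  qed simp
  finally show ?thesis by simp
qed

section \<open>Second phases that can be compressed\<close>

text \<open>The first and third conditions make the second phase compressible given \<open>s\<close>
  and the final state; the second one lets the final state dictate the values of many first
  phases.\<close>

definition typical :: "nat \<Rightarrow> bits \<Rightarrow> (nat \<Rightarrow> nat \<times> bits) \<Rightarrow> bool" where
  "typical h s c \<longleftrightarrow> (\<Sum>i<m. card (Bad s c i)) \<le> 8 * q \<and>
    2 * card {\<omega> \<in> pre s. conflict m (fst \<omega>) c} \<le> card (pre s) \<and>
    h \<le> card {i \<in> {..<p}. changed s i (c i)}"

text \<open>The preimage \<open>wit s i x\<close> also leads to \<open>s\<close>, hence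
  \<open>c\<close> takes it to the same state \<open>F s c\<close>. By correctness both states
  answer \<open>x\<close> with the value stored there, even if another preimage actually
  occurred.\<close>

lemma g2_eq_g1:
  assumes c: "c \<in> \<Omega>2" and x: "x \<in> W s i" "x \<notin> Bad s c i" and i: "i < m"
  shows "g2 (F s c) i x = g1 s i x"
proof -
  have w: "wit s i x \<in> \<Omega>1" "s1 (wit s i x) = s" "fst (fst (wit s i x) i) = x"
    using wit[OF x(1)] by (auto simp: pre_def)
  moreover have "(wit s i x, c) \<in> T"
    using w x c by (auto simp: phases_def Bad_def)
  ultimately show ?thesis
    using g1[of "wit s i x" i] g2_old[of "wit s i x" c i] i by simp
qed

text \<open>All these \<open>c\<close> lie in the graph of \<open>g2 s'\<close>, which disagrees
  with \<open>g1 s\<close> on at most \<open>8 * q\<close> candidate keys in total. Weighting by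
  \<open>t\<close> to the number of changed coordinates turns this into a gain of
  \<open>t ^ h / exp (8 * t)\<close> over the \<open>q ^ p\<close> choices of keys.\<close>

lemma card_typical_le:
  fixes t :: real
  assumes t: "1 \<le> t"
  shows "t ^ h * real (card {c \<in> \<Omega>2. F s c = s' \<and> typical h s c \<and> (\<exists>\<omega>\<in>pre s. (\<omega>, c) \<in> T)})
    \<le> real q ^ p * exp (8 * t)" (is "_ * real (card ?C) \<le> _")
proof (cases "?C = {}")
  case True
  then show ?thesis by (simp only:) simp
next
  case False
  \<comment> \<open>One representative suffices: where \<open>g2 s'\<close> and \<open>g1 s\<close>
    differ depends on \<open>s\<close> and \<open>s'\<close> alone, so \<open>Bad s c0\<close>
    confines the changes of every \<open>c\<close> in \<open>?C\<close>.\<close>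
  then obtain c0 where c0: "c0 \<in> \<Omega>2" "F s c0 = s'" "typical h s c0" by auto
  let ?G = "\<lambda>i. graph_on (g2 s') i {..<q}"
  \<comment> \<open>The compatible preimage in the description of \<open>?C\<close> makes
    \<open>new_in_graph\<close> applicable, so \<open>s'\<close> dictates the values of
    \<open>c\<close>.\<close>
  have sub: "?C \<subseteq> {c \<in> PiE {..<p} ?G. h \<le> card {i \<in> {..<p}. changed s i (c i)}}"
    using new_in_graph by (fastforce simp: pre_def typical_def)
  have fin: "finite (PiE {..<p} ?G)" by (intro finite_PiE) auto
  have "card {z \<in> ?G i. changed s i z} \<le> (if i < m then card (Bad s c0 i) else 0)" for i
  proof (cases "i < m")
    case True
    have "{z \<in> ?G i. changed s i z} \<subseteq> graph_on (g2 s') i (Bad s c0 i)"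
      using g2_eq_g1[OF c0(1) _ _ True] c0(2) by (fastforce simp: graph_on_def changed_def)
    then have "card {z \<in> ?G i. changed s i z} \<le> card (graph_on (g2 s') i (Bad s c0 i))"
      by (intro card_mono) (auto simp: Bad_def)
    then show ?thesis using True by simp
  qed (simp add: changed_def)
  then have "(\<Sum>i<p. card {z \<in> ?G i. changed s i z}) \<le> (\<Sum>i<p. if i < m then card (Bad s c0 i) else 0)"
    by (rule sum_mono)
  also have "\<dots> = (\<Sum>i<m. card (Bad s c0 i))"
    using m by (simp add: sum.If_cases Int_def lessThan_def) (intro sum.cong; auto)
  also have "\<dots> \<le> 8 * q" using c0(3) by (simp add: typical_def)
  finally have S: "(\<Sum>i<p. real (card {z \<in> ?G i. changed s i z})) \<le> 8 * real q"
    by (simp flip: of_nat_sum)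
  have "t ^ h * real (card ?C) \<le> (\<Sum>c\<in>?C. t ^ h)" by simp
  also have "\<dots> \<le> (\<Sum>c\<in>?C. t ^ card {i \<in> {..<p}. changed s i (c i)})"
    using t by (intro sum_mono power_increasing) (auto simp: typical_def)
  also have "\<dots> \<le> (\<Sum>c\<in>PiE {..<p} ?G. t ^ card {i \<in> {..<p}. changed s i (c i)})"
    using fin sub t by (intro sum_mono2) auto
  also have "\<dots> \<le> real q ^ card {..<p} * exp ((t - 1) * (\<Sum>i<p. real (card {z \<in> ?G i. changed s i z})) / real q)"
    using q_pos t by (intro sum_power_card_PiE_le) auto
  also have "\<dots> \<le> real q ^ card {..<p} * exp (8 * t)"
  proof -
    have "(t - 1) * (\<Sum>i<p. real (card {z \<in> ?G i. changed s i z})) / real q \<le> (t - 1) * (8 * real q) / real q"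
      using S t by (intro divide_right_mono mult_left_mono) auto
    also have "\<dots> \<le> 8 * t" using q_pos by simp
    finally show ?thesis by (intro mult_left_mono) auto
  qed
  finally show ?thesis by simp
qed

text \<open>For a typical \<open>c\<close>, half of the preimages of \<open>s\<close> are compatible with \<open>c\<close>, so their values are
  dictated by \<open>s'\<close>; this is what makes \<open>s'\<close> pay for the values of \<open>A\<close> as well.\<close>

lemma card_predecessors_le:
  "card {\<omega> \<in> \<Omega>1. \<exists>c\<in>\<Omega>2. F (s1 \<omega>) c = s' \<and> typical h (s1 \<omega>) c} \<le> 2 * (q ^ m * 2 ^ (p * v))"
proof -
  let ?S = "{s \<in> s1 ` \<Omega>1. \<exists>c\<in>\<Omega>2. F s c = s' \<and> typical h s c}"
  \<comment> \<open>One typical \<open>c s\<close> per state is enough, since every preimage of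
    \<open>s\<close> leads to the same \<open>s\<close>. The compatible preimages are disjoint for
    different \<open>s\<close>, and all lie in one product set determined by
    \<open>s'\<close>.\<close>
  have "\<forall>s\<in>?S. \<exists>c. c \<in> \<Omega>2 \<and> F s c = s' \<and> typical h s c" by auto
  then obtain c where c: "\<And>s. s \<in> ?S \<Longrightarrow> c s \<in> \<Omega>2 \<and> F s (c s) = s' \<and> typical h s (c s)"
    by (meson bchoice)
  let ?ok = "\<lambda>s. {\<omega> \<in> pre s. \<not> conflict m (fst \<omega>) (c s)}"
  have fin: "finite ?S" by simp
  have half: "card (pre s) \<le> 2 * card (?ok s)" if "s \<in> ?S" for s
  proof -
    have "card (pre s) = card ({\<omega> \<in> pre s. conflict m (fst \<omega>) (c s)} \<union> ?ok s)"
      by (rule arg_cong[where f = card]) auto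
    also have "\<dots> = card {\<omega> \<in> pre s. conflict m (fst \<omega>) (c s)} + card (?ok s)"
      by (rule card_Un_disjoint) auto
    finally have "card (pre s) = card {\<omega> \<in> pre s. conflict m (fst \<omega>) (c s)} + card (?ok s)" .
    moreover have "2 * card {\<omega> \<in> pre s. conflict m (fst \<omega>) (c s)} \<le> card (pre s)"
      using c[OF that] by (simp add: typical_def)
    ultimately show ?thesis by linarith
  qed
  have "{\<omega> \<in> \<Omega>1. \<exists>c\<in>\<Omega>2. F (s1 \<omega>) c = s' \<and> typical h (s1 \<omega>) c} = (\<Union>s\<in>?S. pre s)"
    by (auto simp: pre_def)
  then have "card {\<omega> \<in> \<Omega>1. \<exists>c\<in>\<Omega>2. F (s1 \<omega>) c = s' \<and> typical h (s1 \<omega>) c} \<le> (\<Sum>s\<in>?S. card (pre s))"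
    using card_UN_le[OF fin, of pre] by simp
  also have "\<dots> \<le> (\<Sum>s\<in>?S. 2 * card (?ok s))"
    by (intro sum_mono half)
  also have "\<dots> = 2 * card (\<Union>s\<in>?S. ?ok s)"
    by (subst card_UN_disjoint[OF fin]) (auto simp: pre_def sum_distrib_left)
  also have "card (\<Union>s\<in>?S. ?ok s)
      \<le> card (PiE {..<m} (\<lambda>i. graph_on (g2 s') i {..<q}) \<times> PiE {..<p} (\<lambda>_. vals v))"
  proof (rule card_mono[OF finite_old_graph], rule subsetI)
    fix \<omega> assume "\<omega> \<in> (\<Union>s\<in>?S. ?ok s)"
    then obtain s where s: "s \<in> ?S" and \<omega>: "\<omega> \<in> pre s" "\<not> conflict m (fst \<omega>) (c s)" by blast
    have "(\<omega>, c s) \<in> T" "s1 \<omega> = s"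
      using \<omega> c[OF s] by (auto simp: phases_def pre_def)
    then show "\<omega> \<in> PiE {..<m} (\<lambda>i. graph_on (g2 s') i {..<q}) \<times> PiE {..<p} (\<lambda>_. vals v)"
      using old_in_graph[of \<omega> "c s"] c[OF s] by simp
  qed
  finally show ?thesis unfolding card_old_graph by simp
qed

section \<open>Lower and upper counts of the good pairs\<close>

abbreviation "full \<equiv> real (card \<Omega>1) * real (card \<Omega>2)"

lemma full_eq: "full = real q ^ m * 2 ^ N * (real q ^ p * 2 ^ (p * v))"
  by (simp add: card_first_phase card_second_phase)

lemma full_pos: "0 < full"
  unfolding full_eq using q_pos by simp

lemma full_le: "63 * full \<le> 64 * real (card T)"
proof -
  have "real (63 * (card \<Omega>1 * card \<Omega>2)) \<le> real (64 * card T)"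
    using card_phases_ge[OF m(2) m(1) q(1)] by (rule of_nat_mono)
  then show ?thesis by simp
qed

text \<open>Short states could compensate for long ones in the average, but
  \<open>sum_deficit_le\<close> caps this at \<open>4 * full\<close>. The total excess over
  \<open>N\<close> is then at most \<open>2 * R + 5\<close> per pair, and Markov's inequality at
  \<open>k\<close> applies.\<close>

lemma card_long_le:
  assumes sum: "(\<Sum>\<tau>\<in>T. real (length (s1 (fst \<tau>))) + real (length (s2 \<tau>)))
      \<le> 2 * real (card T) * (real N + R)"
    and k: "8 * R + 20 \<le> real k" and R: "0 \<le> R"
  shows "4 * real (card {\<tau> \<in> T. N + k < length (s1 (fst \<tau>)) \<or> N + k < length (s2 \<tau>)}) \<le> real (card T)"
proof -
  let ?l1 = "\<lambda>\<tau>. length (s1 (fst \<tau>))" and ?l2 = "\<lambda>\<tau>. length (s2 \<tau>)"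
  let ?L = "{\<tau> \<in> T. N + k < ?l1 \<tau> \<or> N + k < ?l2 \<tau>}"
  have d1: "(\<Sum>\<tau>\<in>T. N - ?l1 \<tau>) \<le> 2 * (2 ^ N * (q ^ m * card \<Omega>2))"
    by (intro sum_deficit_le finite_phases card_fiber1_le)
  have d2: "(\<Sum>\<tau>\<in>T. N - ?l2 \<tau>) \<le> 2 * (2 ^ N * (q ^ m * 2 ^ (p * v) * q ^ p))"
    by (intro sum_deficit_le finite_phases card_fiber2_le)
  have d1': "(\<Sum>\<tau>\<in>T. real (N - ?l1 \<tau>)) \<le> 2 * full"
    using of_nat_mono[OF d1, where ?'a = real] by (simp add: card_first_phase mult_ac)
  have d2': "(\<Sum>\<tau>\<in>T. real (N - ?l2 \<tau>)) \<le> 2 * full"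
    using of_nat_mono[OF d2, where ?'a = real] by (simp add: card_first_phase card_second_phase mult_ac)
  have "real k * real (card ?L) = (\<Sum>\<tau>\<in>?L. real k)" by simp
  also have "\<dots> \<le> (\<Sum>\<tau>\<in>?L. real (?l1 \<tau> - N) + real (?l2 \<tau> - N))"
  proof (intro sum_mono)
    fix \<tau> assume "\<tau> \<in> ?L"
    then have "k \<le> (?l1 \<tau> - N) + (?l2 \<tau> - N)" by auto
    then show "real k \<le> real (?l1 \<tau> - N) + real (?l2 \<tau> - N)"
      by (simp only: of_nat_le_iff flip: of_nat_add)
  qed
  also have "\<dots> \<le> (\<Sum>\<tau>\<in>T. real (?l1 \<tau> - N) + real (?l2 \<tau> - N))"
    by (intro sum_mono2) auto
  also have "\<dots> = (\<Sum>\<tau>\<in>T. (real (?l1 \<tau>) + real (?l2 \<tau>)) - 2 * real N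
      + real (N - ?l1 \<tau>) + real (N - ?l2 \<tau>))"
  proof (intro sum.cong refl)
    have diff: "real (a - b) = real a - real b + real (b - a)" for a b :: nat by linarith
    show "real (?l1 \<tau> - N) + real (?l2 \<tau> - N) = (real (?l1 \<tau>) + real (?l2 \<tau>)) - 2 * real N
      + real (N - ?l1 \<tau>) + real (N - ?l2 \<tau>)" for \<tau>
      unfolding diff[of "?l1 \<tau>" N] diff[of "?l2 \<tau>" N] by simp
  qed
  also have "\<dots> = (\<Sum>\<tau>\<in>T. real (?l1 \<tau>) + real (?l2 \<tau>)) - real (card T) * (2 * real N)
      + (\<Sum>\<tau>\<in>T. real (N - ?l1 \<tau>)) + (\<Sum>\<tau>\<in>T. real (N - ?l2 \<tau>))"
    by (simp only: sum.distrib sum_subtractf sum_constant)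
  also have "\<dots> \<le> 2 * real (card T) * (real N + R) - real (card T) * (2 * real N) + 2 * full + 2 * full"
    using sum d1' d2' by linarith
  also have "\<dots> = 2 * R * real (card T) + 4 * full" by (simp only: algebra_simps)
  \<comment> \<open>The 5 absorbs \<open>4 * 64 / 63\<close>, the cost of passing from
    \<open>full\<close> to \<open>card T\<close>.\<close>
  also have "\<dots> \<le> 2 * R * real (card T) + 5 * real (card T)"
    using full_le by linarith
  also have "\<dots> = (8 * R + 20) * real (card T) / 4" by (simp add: field_simps)
  also have "\<dots> \<le> real k * real (card T) / 4"
    using k by (intro divide_right_mono mult_right_mono) auto
  finally have "real k * (4 * real (card ?L)) \<le> real k * real (card T)" by simp
  moreover have "0 < real k" using k R by linarith
  ultimately show ?thesis by (simp only: mult_le_cancel_left_pos)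
qed

text \<open>Fewer than \<open>2 ^ (N + k + 1)\<close> states have length at most
  \<open>N + k\<close>. Those with fewer than \<open>q ^ m / 2 ^ (k + 4)\<close> preimages together
  cover at most an eighth of \<open>\<Omega>1\<close>.\<close>

lemma card_thin_le:
  "8 * card {\<omega> \<in> \<Omega>1. length (s1 \<omega>) \<le> N + k \<and> 2 ^ (k + 4) * card (pre (s1 \<omega>)) < q ^ m} \<le> card \<Omega>1"
proof -
  let ?X = "{\<omega> \<in> \<Omega>1. 2 ^ (k + 4) * card (pre (s1 \<omega>)) < q ^ m}"
  let ?B = "q ^ m div 2 ^ (k + 4)"
  have "card {\<omega> \<in> ?X. s1 \<omega> = s} \<le> ?B" for s
  proof (cases "2 ^ (k + 4) * card (pre s) < q ^ m")
    case True
    have "card {\<omega> \<in> ?X. s1 \<omega> = s} \<le> card (pre s)"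
      by (intro card_mono) (auto simp: pre_def)
    also have "card (pre s) \<le> ?B"
      using True by (simp add: less_eq_div_iff_mult_less_eq mult.commute)
    finally show ?thesis .
  next
    case False
    then have "{\<omega> \<in> ?X. s1 \<omega> = s} = {}" by auto
    then show ?thesis by (simp only:) simp
  qed
  then have "card {\<omega> \<in> ?X. length (s1 \<omega>) \<le> N + k} \<le> 2 ^ (N + k + 1) * ?B"
    by (intro card_short_le) auto
  moreover have "{\<omega> \<in> ?X. length (s1 \<omega>) \<le> N + k}
      = {\<omega> \<in> \<Omega>1. length (s1 \<omega>) \<le> N + k \<and> 2 ^ (k + 4) * card (pre (s1 \<omega>)) < q ^ m}"
    by auto
  ultimately have "8 * card {\<omega> \<in> \<Omega>1. length (s1 \<omega>) \<le> N + k \<and> 2 ^ (k + 4) * card (pre (s1 \<omega>)) < q ^ m}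
      \<le> 8 * (2 ^ (N + k + 1) * ?B)" by simp
  also have "\<dots> = 2 ^ N * (2 ^ (k + 4) * ?B)"
    by (simp add: power_add)
  also have "\<dots> \<le> 2 ^ N * q ^ m"
    by (intro mult_left_mono) (auto simp: mult.commute)
  finally show ?thesis by (simp add: card_first_phase mult.commute)
qed

lemma card_atypical_le:
  assumes pre: "q ^ m \<le> 2 ^ r * card (pre s)"
    and h: "8 * real h \<le> real m * 2 powr (- (real r / real m))"
    and h2: "32 \<le> real m * 2 powr (- (real r / real m))"
  shows "32 * card {c \<in> \<Omega>2. \<not> typical h s c} \<le> 3 * card \<Omega>2"
proof -
  let ?A = "{c \<in> \<Omega>2. 8 * q < (\<Sum>i<m. card (Bad s c i))}"
  let ?B = "{c \<in> \<Omega>2. card (pre s) < 2 * card {\<omega> \<in> pre s. conflict m (fst \<omega>) c}}"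
  let ?C = "{c \<in> \<Omega>2. card {i \<in> {..<p}. changed s i (c i)} < h}"
  have ne: "pre s \<noteq> {}"
  proof
    assume "pre s = {}"
    then have "q ^ m \<le> 0" using pre by simp
    then show False using q_pos by simp
  qed
  have "{c \<in> \<Omega>2. \<not> typical h s c} = (?A \<union> ?B) \<union> ?C"
    by (auto simp: typical_def not_le)
  then have "card {c \<in> \<Omega>2. \<not> typical h s c} \<le> card ?A + card ?B + card ?C"
    using card_Un_le[of "?A \<union> ?B" ?C] card_Un_le[of ?A ?B] by simp
  then show ?thesis
    using card_bad_le[of s] card_half_conflict_le[OF ne] card_few_changed_le[OF pre h h2] by linarith
qed

text \<open>In units of \<open>full\<close>, \<open>T\<close> has at least \<open>63 / 64\<close>.
  Long states remove at most a quarter of \<open>T\<close>, thin preimages at most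
  \<open>1 / 8\<close> and atypical second phases at most \<open>3 / 32\<close>, so more than a
  quarter remains.\<close>

lemma card_good_ge:
  assumes sum: "(\<Sum>\<tau>\<in>T. real (length (s1 (fst \<tau>))) + real (length (s2 \<tau>)))
      \<le> 2 * real (card T) * (real N + R)"
    and k: "8 * R + 20 \<le> real k" and R: "0 \<le> R"
    and h: "8 * real h \<le> real m * 2 powr (- (real (k + 4) / real m))"
    and h2: "32 \<le> real m * 2 powr (- (real (k + 4) / real m))"
  shows "full \<le> 4 * real (card {\<tau> \<in> T. typical h (s1 (fst \<tau>)) (snd \<tau>) \<and> length (s2 \<tau>) \<le> N + k})"
proof -
  let ?L = "{\<tau> \<in> T. N + k < length (s1 (fst \<tau>)) \<or> N + k < length (s2 \<tau>)}"
  let ?t = "{\<omega> \<in> \<Omega>1. length (s1 \<omega>) \<le> N + k \<and> 2 ^ (k + 4) * card (pre (s1 \<omega>)) < q ^ m}"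
  let ?a = "{\<omega> \<in> \<Omega>1. q ^ m \<le> 2 ^ (k + 4) * card (pre (s1 \<omega>))}"
  let ?A = "SIGMA \<omega> : ?a. {c \<in> \<Omega>2. \<not> typical h (s1 \<omega>) c}"
  let ?G = "{\<tau> \<in> T. typical h (s1 (fst \<tau>)) (snd \<tau>) \<and> length (s2 \<tau>) \<le> N + k}"
  have "T \<subseteq> ((?L \<union> ?t \<times> \<Omega>2) \<union> ?A) \<union> ?G"
    by (auto simp: phases_def not_le not_less)
  then have "card T \<le> card (((?L \<union> ?t \<times> \<Omega>2) \<union> ?A) \<union> ?G)"
    by (intro card_mono) auto
  also have "\<dots> \<le> card ((?L \<union> ?t \<times> \<Omega>2) \<union> ?A) + card ?G" by (rule card_Un_le)
  also have "card ((?L \<union> ?t \<times> \<Omega>2) \<union> ?A) \<le> card (?L \<union> ?t \<times> \<Omega>2) + card ?A" by (rule card_Un_le)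
  also have "card (?L \<union> ?t \<times> \<Omega>2) \<le> card ?L + card (?t \<times> \<Omega>2)" by (rule card_Un_le)
  finally have T: "real (card T) \<le> real (card ?L) + real (card (?t \<times> \<Omega>2)) + real (card ?A) + real (card ?G)"
    by (simp only: of_nat_le_iff flip: of_nat_add)
  have thin: "8 * real (card (?t \<times> \<Omega>2)) \<le> full"
  proof -
    have "8 * card ?t * card \<Omega>2 \<le> card \<Omega>1 * card \<Omega>2"
      using card_thin_le by (rule mult_right_mono) simp
    then have "8 * card (?t \<times> \<Omega>2) \<le> card \<Omega>1 * card \<Omega>2"
      by (simp only: card_cartesian_product mult_ac)
    then have "real (8 * card (?t \<times> \<Omega>2)) \<le> real (card \<Omega>1 * card \<Omega>2)" by (rule of_nat_mono)
    then show ?thesis by simp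
  qed
  have atyp: "32 * real (card ?A) \<le> 3 * full"
  proof -
    have "32 * card ?A = (\<Sum>\<omega>\<in>?a. 32 * card {c \<in> \<Omega>2. \<not> typical h (s1 \<omega>) c})"
      by (subst card_SigmaI) (auto simp: sum_distrib_left)
    also have "\<dots> \<le> (\<Sum>\<omega>\<in>?a. 3 * card \<Omega>2)"
      by (intro sum_mono card_atypical_le[where r = "k + 4"] h h2) auto
    also have "\<dots> = card ?a * (3 * card \<Omega>2)" by simp
    also have "\<dots> \<le> card \<Omega>1 * (3 * card \<Omega>2)"
      by (intro mult_right_mono card_mono) auto
    finally have "real (32 * card ?A) \<le> real (card \<Omega>1 * (3 * card \<Omega>2))" by (rule of_nat_mono)
    then show ?thesis by simp
  qed
  show ?thesis
    using T thin atyp card_long_le[OF sum k R] full_le full_pos by linarith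
qed

text \<open>Each short \<open>s'\<close> is reached from at most
  \<open>2 * (q ^ m * 2 ^ (p * v))\<close> first phases, and from each of them by at most
  \<open>q ^ p * exp (8 * t) / t ^ h\<close> typical second phases; \<open>card_short_le\<close>
  sums over \<open>s'\<close>.\<close>

lemma card_good_le:
  fixes t :: real
  assumes t: "1 \<le> t"
  shows "t ^ h * real (card {\<tau> \<in> T. typical h (s1 (fst \<tau>)) (snd \<tau>) \<and> length (s2 \<tau>) \<le> N + k})
    \<le> 2 ^ (k + 2) * exp (8 * t) * full"
proof -
  let ?G = "{\<tau> \<in> T. typical h (s1 (fst \<tau>)) (snd \<tau>)}"
  let ?b = "2 * (real q ^ m * 2 ^ (p * v)) * (real q ^ p * exp (8 * t)) / t ^ h"
  have tpos: "0 < t ^ h" using t by simp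
  \<comment> \<open>\<open>card_short_le\<close> expects a natural number, hence the floor of
    \<open>?b\<close>.\<close>
  have "card {\<tau> \<in> ?G. s2 \<tau> = s'} \<le> nat \<lfloor>?b\<rfloor>" for s'
  proof -
    let ?P = "{\<omega> \<in> \<Omega>1. \<exists>c\<in>\<Omega>2. F (s1 \<omega>) c = s' \<and> typical h (s1 \<omega>) c}"
    let ?C = "\<lambda>s. {c \<in> \<Omega>2. F s c = s' \<and> typical h s c \<and> (\<exists>\<omega>\<in>pre s. (\<omega>, c) \<in> T)}"
    have "{\<tau> \<in> ?G. s2 \<tau> = s'} \<subseteq> (SIGMA \<omega> : ?P. ?C (s1 \<omega>))"
    proof
      fix \<tau> assume "\<tau> \<in> {\<tau> \<in> ?G. s2 \<tau> = s'}"
      then have "(fst \<tau>, snd \<tau>) \<in> T" "fst \<tau> \<in> \<Omega>1" "fst \<tau> \<in> pre (s1 (fst \<tau>))" "snd \<tau> \<in> \<Omega>2"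
        "typical h (s1 (fst \<tau>)) (snd \<tau>)" "s2 \<tau> = s'"
        by (auto simp: phases_def pre_def)
      then show "\<tau> \<in> (SIGMA \<omega> : ?P. ?C (s1 \<omega>))"
        by (subst mem_Sigma_iff[of "fst \<tau>" "snd \<tau>", simplified]) blast
    qed
    then have "card {\<tau> \<in> ?G. s2 \<tau> = s'} \<le> card (SIGMA \<omega> : ?P. ?C (s1 \<omega>))"
      by (intro card_mono) auto
    also have "\<dots> = (\<Sum>\<omega>\<in>?P. card (?C (s1 \<omega>)))"
      by (rule card_SigmaI) auto
    finally have "t ^ h * real (card {\<tau> \<in> ?G. s2 \<tau> = s'}) \<le> t ^ h * real (\<Sum>\<omega>\<in>?P. card (?C (s1 \<omega>)))"
      using tpos by (intro mult_left_mono of_nat_mono) auto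
    also have "\<dots> = (\<Sum>\<omega>\<in>?P. t ^ h * real (card (?C (s1 \<omega>))))"
      by (simp add: sum_distrib_left)
    also have "\<dots> \<le> (\<Sum>\<omega>\<in>?P. real q ^ p * exp (8 * t))"
      by (intro sum_mono card_typical_le t)
    also have "\<dots> = real (card ?P) * (real q ^ p * exp (8 * t))" by simp
    also have "\<dots> \<le> real (2 * (q ^ m * 2 ^ (p * v))) * (real q ^ p * exp (8 * t))"
      by (intro mult_right_mono of_nat_mono card_predecessors_le) auto
    finally have "real (card {\<tau> \<in> ?G. s2 \<tau> = s'}) \<le> ?b"
      using tpos by (simp add: pos_le_divide_eq mult.commute)
    then show ?thesis by (simp only: le_nat_floor)
  qed
  then have "card {\<tau> \<in> ?G. length (s2 \<tau>) \<le> N + k} \<le> 2 ^ (N + k + 1) * nat \<lfloor>?b\<rfloor>"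
    by (intro card_short_le) auto
  then have "real (card {\<tau> \<in> ?G. length (s2 \<tau>) \<le> N + k}) \<le> 2 ^ (N + k + 1) * real (nat \<lfloor>?b\<rfloor>)"
    using of_nat_mono[where ?'a = real] by fastforce
  also have "\<dots> \<le> 2 ^ (N + k + 1) * ?b"
    using tpos by (intro mult_left_mono of_nat_floor) auto
  finally have "t ^ h * real (card {\<tau> \<in> ?G. length (s2 \<tau>) \<le> N + k}) \<le> t ^ h * (2 ^ (N + k + 1) * ?b)"
    using tpos by (intro mult_left_mono) auto
  also have "\<dots> = 2 ^ (k + 2) * exp (8 * t) * full"
    using t unfolding full_eq by (simp add: power_add)
  finally show ?thesis by simp
qed

text \<open>Both counts of the good pairs carry the factor \<open>full\<close>; cancelling it
  removes \<open>q\<close> and \<open>v\<close> from the conclusion.\<close>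

lemma two_phase_bound:
  fixes t :: real
  assumes sum: "(\<Sum>\<tau>\<in>T. real (length (s1 (fst \<tau>))) + real (length (s2 \<tau>)))
      \<le> 2 * real (card T) * (real N + R)"
    and k: "8 * R + 20 \<le> real k" and R: "0 \<le> R"
    and h: "8 * real h \<le> real m * 2 powr (- (real (k + 4) / real m))"
    and h2: "32 \<le> real m * 2 powr (- (real (k + 4) / real m))"
    and t: "1 \<le> t"
  shows "t ^ h \<le> 2 ^ (k + 4) * exp (8 * t)"
proof -
  let ?G = "real (card {\<tau> \<in> T. typical h (s1 (fst \<tau>)) (snd \<tau>) \<and> length (s2 \<tau>) \<le> N + k})"
  have "t ^ h * full \<le> t ^ h * (4 * ?G)"
    using card_good_ge[OF sum k R h h2] t by (intro mult_left_mono) auto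
  also have "\<dots> = 4 * (t ^ h * ?G)" by simp
  also have "\<dots> \<le> 4 * (2 ^ (k + 2) * exp (8 * t) * full)"
    by (intro mult_left_mono card_good_le t) auto
  also have "\<dots> = 2 ^ (k + 4) * exp (8 * t) * full" by (simp add: power_add)
  finally show ?thesis using full_pos by (simp only: mult_le_cancel_right_pos)
qed

end

section \<open>Choice of the parameters\<close>

text \<open>With \<open>k\<close> close to \<open>8 * R\<close>, the quantity \<open>\<mu>\<close>
  is at least of order n / sqrt (log n), so \<open>t = sqrt n\<close> makes
  \<open>ln (t ^ h)\<close> at least of order n sqrt (log n). The other side has a logarithm of
  order n log log n only.\<close>

lemma eventually_parameters:
  "\<forall>\<^sub>F n in sequentially. \<exists>k h. \<exists>t::real.
     8 * (1 / 48 * (real n * log 2 (log 2 (real n)))) + 20 \<le> real k \<and>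
     0 \<le> 1 / 48 * (real n * log 2 (log 2 (real n))) \<and>
     8 * real h \<le> real (n div 2) * 2 powr (- (real (k + 4) / real (n div 2))) \<and>
     32 \<le> real (n div 2) * 2 powr (- (real (k + 4) / real (n div 2))) \<and>
     1 \<le> t \<and> 2 ^ (k + 4) * exp (8 * t) < t ^ h"
proof -
  have e1: "\<forall>\<^sub>F n in sequentially. 0 \<le> log 2 (log 2 (real n))"
    by real_asymp
  have e2: "\<forall>\<^sub>F n in sequentially. 32 \<le> real n / (6 * sqrt (log 2 (real n)))"
    by real_asymp
  have e3: "\<forall>\<^sub>F n in sequentially. (real n * log 2 (log 2 (real n)) / 6 + 25) * ln 2 + 8 * sqrt (real n)
      < (real n / (48 * sqrt (log 2 (real n))) - 1) * (ln (real n) / 2)"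
    by real_asymp
  show ?thesis
    using e1 e2 e3 eventually_ge_at_top[of 100]
  proof eventually_elim
    case (elim n)
    define l where "l = log 2 (log 2 (real n))"
    \<comment> \<open>The factor \<open>1 / 48\<close> makes \<open>8 * R / (n / 3)\<close> equal to
      \<open>l / 2\<close>, so \<open>2 powr (- (k / m))\<close> costs only a square root of
      \<open>log 2 n\<close>.\<close>
    define R where "R = 1 / 48 * (real n * l)"
    define k where "k = nat \<lceil>8 * R + 20\<rceil>"
    define m where "m = n div 2"
    define \<mu> where "\<mu> = real m * 2 powr (- (real (k + 4) / real m))"
    define h where "h = nat \<lfloor>\<mu> / 8\<rfloor>"
    \<comment> \<open>A power of \<open>n\<close> below the first keeps \<open>8 * t\<close>
      negligible against \<open>n\<close>, while \<open>ln t\<close> is still a constant multiple of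
      \<open>ln n\<close>.\<close>
    define t where "t = sqrt (real n)"
    have l: "0 \<le> l" and n: "100 \<le> n" using elim by (auto simp: l_def)
    have R: "0 \<le> R" using l by (simp add: R_def)
    have k: "8 * R + 20 \<le> real k" "real k \<le> 8 * R + 21"
      using R unfolding k_def by linarith+
    have m: "real n / 3 \<le> real m" using n unfolding m_def by linarith
    have mpos: "0 < real m" using m n by linarith
    have log_pos: "0 < log 2 (real n)" using n by simp
    have "real (k + 4) / real m \<le> (8 * R + 25) / real m"
      using k mpos by (intro divide_right_mono) auto
    also have "\<dots> \<le> (8 * R + 25) / (real n / 3)"
      using m n R by (intro divide_left_mono mult_pos_pos) auto
    also have "\<dots> = l / 2 + 75 / real n" using n by (simp add: R_def field_simps)
    also have "\<dots> \<le> l / 2 + 1" using n by simp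
    finally have "2 powr (- (l / 2 + 1)) \<le> 2 powr (- (real (k + 4) / real m))"
      by (intro powr_mono) auto
    moreover have "2 powr (- (l / 2 + 1)) = 1 / (2 * sqrt (log 2 (real n)))"
    proof -
      have "2 powr (l / 2) = (2 powr l) powr (1 / 2)" by (simp add: powr_powr)
      also have "2 powr l = log 2 (real n)" unfolding l_def using log_pos by simp
      finally have "2 powr (l / 2) = sqrt (log 2 (real n))" using log_pos by (simp add: powr_half_sqrt)
      then have "2 powr (l / 2 + 1) = 2 * sqrt (log 2 (real n))" by (simp add: powr_add)
      then show ?thesis by (simp only: powr_minus_divide)
    qed
    ultimately have le: "1 / (2 * sqrt (log 2 (real n))) \<le> 2 powr (- (real (k + 4) / real m))"
      by (simp only:)
    have "real n / 3 * (1 / (2 * sqrt (log 2 (real n)))) \<le> \<mu>"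
      unfolding \<mu>_def by (rule mult_mono[OF m le]) (use log_pos in auto)
    then have \<mu>: "real n / (6 * sqrt (log 2 (real n))) \<le> \<mu>" by simp
    then have \<mu>32: "32 \<le> \<mu>" using elim by linarith
    have h: "8 * real h \<le> \<mu>" "\<mu> / 8 - 1 \<le> real h"
      using \<mu>32 unfolding h_def by linarith+
    have t: "1 \<le> t" using n by (simp add: t_def)
    have "2 ^ (k + 4) * exp (8 * t) < t ^ h"
    proof -
      have "2 ^ (k + 4) * exp (8 * t) = exp (real (k + 4) * ln 2 + 8 * t)"
        by (simp add: exp_add exp_of_nat_mult del: of_nat_add)
      moreover have "t ^ h = exp (real h * (ln (real n) / 2))"
        using t n by (simp add: exp_of_nat_mult t_def flip: ln_sqrt)
      moreover have "real (k + 4) * ln 2 + 8 * t < real h * (ln (real n) / 2)"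
      proof -
        have "real (k + 4) * ln 2 + 8 * t \<le> (real n * l / 6 + 25) * ln 2 + 8 * sqrt (real n)"
          unfolding t_def using k by (intro add_right_mono mult_right_mono) (auto simp: R_def mult.commute)
        also have "\<dots> < (real n / (48 * sqrt (log 2 (real n))) - 1) * (ln (real n) / 2)"
          using elim by (simp add: l_def)
        also have "\<dots> \<le> real h * (ln (real n) / 2)"
        proof (rule mult_right_mono)
          have "real n / (48 * sqrt (log 2 (real n))) = real n / (6 * sqrt (log 2 (real n))) / 8"
            by simp
          then show "real n / (48 * sqrt (log 2 (real n))) - 1 \<le> real h"
            using \<mu> h by linarith
        qed (use n in auto)
        finally show ?thesis .
      qed
      ultimately show ?thesis by simp
    qed
    then show ?case
      using k R h \<mu>32 t unfolding \<mu>_def m_def R_def l_def by blast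
  qed
qed

section \<open>Realisation by operation sequences\<close>

lemma run_from_append:
  "run_from D \<omega> t s (xs @ ys) = run_from D \<omega> (t + length xs) (run_from D \<omega> t s xs) ys"
  by (induction xs arbitrary: t s) auto

lemma admissible_from_append:
  "admissible_from U n v M (xs @ ys) \<longleftrightarrow>
     admissible_from U n v M xs \<and> admissible_from U n v (foldl apply_op M xs) ys"
  by (induction xs arbitrary: M) auto

text \<open>The start map is arbitrary so that the lemma serves all three rounds: \<open>A\<close>
  into the empty map, then \<open>C\<close>, and later \<open>B\<close> after the deletion of
  \<open>C\<close>.\<close>

lemma inserts:
  assumes "distinct is" "inj_on \<kappa> (set is)" "finite (dom M)" "\<kappa> ` set is \<subseteq> U - dom M"
    "card (dom M) + length is \<le> n" "\<forall>i\<in>set is. length (\<phi> i) = v"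
  shows "admissible_from U n v M (map (\<lambda>i. Insert (\<kappa> i) (\<phi> i)) is) \<and>
    (\<forall>i\<in>set is. foldl apply_op M (map (\<lambda>i. Insert (\<kappa> i) (\<phi> i)) is) (\<kappa> i) = Some (\<phi> i)) \<and>
    (\<forall>k. k \<notin> \<kappa> ` set is \<longrightarrow> foldl apply_op M (map (\<lambda>i. Insert (\<kappa> i) (\<phi> i)) is) k = M k) \<and>
    dom (foldl apply_op M (map (\<lambda>i. Insert (\<kappa> i) (\<phi> i)) is)) = dom M \<union> \<kappa> ` set is"
  using assms
proof (induction "is" arbitrary: M)
  case (Cons a "is")
  define M1 where "M1 = apply_op M (Insert (\<kappa> a) (\<phi> a))"
  have M1: "M1 (\<kappa> a) = Some (\<phi> a)" "\<And>k. k \<noteq> \<kappa> a \<Longrightarrow> M1 k = M k" "dom M1 = insert (\<kappa> a) (dom M)"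
    by (auto simp: M1_def)
  have new: "\<kappa> a \<notin> dom M" "\<kappa> a \<notin> \<kappa> ` set is" "\<kappa> a \<in> U" using Cons.prems by auto
  from new(2) have ne: "\<forall>i\<in>set is. \<kappa> i \<noteq> \<kappa> a" by (metis imageI)
  have "distinct is" "inj_on \<kappa> (set is)" "finite (dom M1)" "\<kappa> ` set is \<subseteq> U - dom M1"
    "card (dom M1) + length is \<le> n" "\<forall>i\<in>set is. length (\<phi> i) = v"
    unfolding M1(3) using Cons.prems new ne by auto
  note IH = Cons.IH[OF this]
  have "admissible U n v M (Insert (\<kappa> a) (\<phi> a))" using Cons.prems new by simp
  then show ?case
    using IH M1 new(2) unfolding list.map foldl_Cons admissible_from.simps M1_def[symmetric] by simp
qed auto

lemma deletes:
  assumes "distinct is" "inj_on \<kappa> (set is)" "\<kappa> ` set is \<subseteq> dom M"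
  shows "admissible_from U n v M (map (\<lambda>i. Delete (\<kappa> i)) is) \<and>
    (\<forall>k. k \<notin> \<kappa> ` set is \<longrightarrow> foldl apply_op M (map (\<lambda>i. Delete (\<kappa> i)) is) k = M k) \<and>
    dom (foldl apply_op M (map (\<lambda>i. Delete (\<kappa> i)) is)) = dom M - \<kappa> ` set is"
  using assms
proof (induction "is" arbitrary: M)
  case (Cons a "is")
  define M1 where "M1 = apply_op M (Delete (\<kappa> a))"
  have M1: "\<And>k. k \<noteq> \<kappa> a \<Longrightarrow> M1 k = M k" "dom M1 = dom M - {\<kappa> a}"
    by (auto simp: M1_def)
  have new: "\<kappa> a \<notin> \<kappa> ` set is" using Cons.prems by auto
  then have ne: "\<forall>i\<in>set is. \<kappa> i \<noteq> \<kappa> a" by (metis imageI)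
  have "distinct is" "inj_on \<kappa> (set is)" "\<kappa> ` set is \<subseteq> dom M1"
    unfolding M1(2) using Cons.prems ne by auto
  note IH = Cons.IH[OF this]
  have "admissible U n v M (Delete (\<kappa> a))" using Cons.prems by simp
  then show ?case
    using IH M1 unfolding list.map foldl_Cons admissible_from.simps M1_def[symmetric] by auto
qed auto

text \<open>The averaging direction of Yao's principle: a bound for every fixed tape survives
  integration over the tape. The integral may be exchanged with the finite sum because states after
  admissible sequences are measurable.\<close>

lemma expected_size_uniform_ge:
  assumes A: "finite A" "A \<noteq> {}" and g: "\<And>a. a \<in> A \<Longrightarrow> g a \<in> op_sequences U n v"
    and D: "dynamic_retrieval U n v M D" and r: "0 \<le> r"
    and ge: "\<And>\<omega>. \<omega> \<in> space M \<Longrightarrow>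
      real (card A) * r \<le> (\<Sum>a\<in>A. real (length (state_after D \<omega> (g a))))"
  shows "ennreal r \<le> expected_size M D (map_pmf g (pmf_of_set A))"
proof -
  interpret prob_space M using D by (simp add: dynamic_retrieval_def)
  have card: "0 < card A" using A by (simp add: card_gt_0_iff)
  have meas: "(\<lambda>\<omega>. ennreal (real (length (state_after D \<omega> (g a))))) \<in> borel_measurable M"
    if "a \<in> A" for a
  proof -
    have "(\<lambda>\<omega>. state_after D \<omega> (g a)) \<in> measurable M (count_space UNIV)"
      using D g[OF that] by (auto simp: dynamic_retrieval_def)
    then show ?thesis by (rule measurable_compose) simp
  qed
  have "ennreal (real (card A) * r) = (\<integral>\<^sup>+\<omega>. ennreal (real (card A) * r) \<partial>M)"
    by (simp add: emeasure_space_1)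
  also have "\<dots> \<le> (\<integral>\<^sup>+\<omega>. (\<Sum>a\<in>A. ennreal (real (length (state_after D \<omega> (g a))))) \<partial>M)"
    by (intro nn_integral_mono) (simp add: ge ennreal_leI sum_ennreal)
  also have "\<dots> = (\<Sum>a\<in>A. \<integral>\<^sup>+\<omega>. ennreal (real (length (state_after D \<omega> (g a)))) \<partial>M)"
    by (intro nn_integral_sum meas)
  finally have "ennreal (real (card A) * r) / ennreal (real (card A))
      \<le> (\<Sum>a\<in>A. \<integral>\<^sup>+\<omega>. ennreal (real (length (state_after D \<omega> (g a)))) \<partial>M) / ennreal (real (card A))"
    by (rule divide_right_mono_ennreal)
  moreover have "ennreal (real (card A) * r) / ennreal (real (card A)) = ennreal r"
    using card r by (subst divide_ennreal) auto
  moreover have "expected_size M D (map_pmf g (pmf_of_set A))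
      = (\<Sum>a\<in>A. \<integral>\<^sup>+\<omega>. ennreal (real (length (state_after D \<omega> (g a)))) \<partial>M) / ennreal (real (card A))"
    unfolding expected_size_def using A by (simp add: nn_integral_pmf_of_set ennreal_of_nat_eq_real_of_nat)
  ultimately show ?thesis by simp
qed

section \<open>Admissibility and contents of the two phases\<close>

locale key_blocks =
  fixes U :: "nat set" and m p q v :: nat and key :: "nat \<Rightarrow> nat \<Rightarrow> nat" and ck :: "nat \<Rightarrow> nat"
  assumes m_le: "m \<le> p"
    and key_U: "\<And>i x. i < p \<Longrightarrow> x < q \<Longrightarrow> key i x \<in> U"
    and ck_U: "\<And>j. j < p \<Longrightarrow> ck j \<in> U"
    and key_eq: "\<And>i x i' x'. i < p \<Longrightarrow> x < q \<Longrightarrow> i' < p \<Longrightarrow> x' < q \<Longrightarrow>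
      key i x = key i' x' \<Longrightarrow> i = i' \<and> x = x'"
    and ck_inj: "inj_on ck {..<p}"
    and key_ck: "\<And>i x j. i < p \<Longrightarrow> x < q \<Longrightarrow> j < p \<Longrightarrow> key i x \<noteq> ck j"
begin

definition ops1 :: "(nat \<Rightarrow> nat \<times> bits) \<times> (nat \<Rightarrow> bits) \<Rightarrow> operation list" where
  "ops1 \<omega> = map (\<lambda>i. Insert (key i (fst (fst \<omega> i))) (snd (fst \<omega> i))) [0..<m]
    @ map (\<lambda>j. Insert (ck j) (snd \<omega> j)) [0..<p]"

definition ops2 :: "(nat \<Rightarrow> nat \<times> bits) \<Rightarrow> operation list" where
  "ops2 c = map (\<lambda>j. Delete (ck j)) [0..<p]
    @ map (\<lambda>i. Insert (key i (fst (c i))) (snd (c i))) [0..<p]"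

lemma length_ops1 [simp]: "length (ops1 \<omega>) = m + p"
  by (simp add: ops1_def)

lemma first_phase_key:
  assumes "\<omega> \<in> first_phase m p q v" "i < m"
  shows "fst (fst \<omega> i) < q" "length (snd (fst \<omega> i)) = v"
  using assms by (auto simp: first_phase_def vals_def PiE_iff mem_Times_iff)

lemma second_phase_key:
  assumes "c \<in> second_phase p q v" "i < p"
  shows "fst (c i) < q" "length (snd (c i)) = v"
  using assms by (auto simp: second_phase_def vals_def PiE_iff mem_Times_iff)

lemma ops1:
  assumes \<omega>: "\<omega> \<in> first_phase m p q v"
  shows "ops1 \<omega> \<in> op_sequences U (m + p) v"
    and "\<And>i. i < m \<Longrightarrow> contents (ops1 \<omega>) (key i (fst (fst \<omega> i))) = Some (snd (fst \<omega> i))"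
    and "\<And>j. j < p \<Longrightarrow> contents (ops1 \<omega>) (ck j) = Some (snd \<omega> j)"
    and "dom (contents (ops1 \<omega>)) = (\<lambda>i. key i (fst (fst \<omega> i))) ` {..<m} \<union> ck ` {..<p}"
proof -
  let ?\<kappa> = "\<lambda>i. key i (fst (fst \<omega> i))"
  let ?A = "map (\<lambda>i. Insert (?\<kappa> i) (snd (fst \<omega> i))) [0..<m]"
  let ?C = "map (\<lambda>j. Insert (ck j) (snd \<omega> j)) [0..<p]"
  let ?M = "foldl apply_op Map.empty ?A"
  note fp = first_phase_key[OF \<omega>]
  have inj: "inj_on ?\<kappa> {0..<m}"
    using key_eq fp m_le by (intro inj_onI) (metis atLeastLessThan_iff order_less_le_trans)
  have U: "?\<kappa> ` {0..<m} \<subseteq> U"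
    using key_U fp m_le by (auto intro: order_less_le_trans)
  have "admissible_from U (m + p) v Map.empty ?A \<and>
    (\<forall>i\<in>set [0..<m]. ?M (?\<kappa> i) = Some (snd (fst \<omega> i))) \<and>
    (\<forall>k. k \<notin> ?\<kappa> ` set [0..<m] \<longrightarrow> ?M k = (Map.empty :: nat \<rightharpoonup> bits) k) \<and>
    dom ?M = dom (Map.empty :: nat \<rightharpoonup> bits) \<union> ?\<kappa> ` set [0..<m]"
    by (rule inserts[where M = Map.empty]) (use inj U fp in auto)
  then have A: "admissible_from U (m + p) v Map.empty ?A"
    "\<And>i. i < m \<Longrightarrow> ?M (?\<kappa> i) = Some (snd (fst \<omega> i))"
    "dom ?M = ?\<kappa> ` {0..<m}" by simp_all
  have disj: "?\<kappa> i \<noteq> ck j" if "i < m" "j < p" for i j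
    using key_ck fp that m_le by auto
  then have disj_img: "?\<kappa> i \<notin> ck ` {0..<p}" if "i < m" for i
    using that by (metis atLeastLessThan_iff imageE)
  have \<gamma>: "\<And>j. j < p \<Longrightarrow> length (snd \<omega> j) = v"
    using \<omega> by (auto simp: first_phase_def vals_def)
  have card: "card (dom ?M) \<le> m" unfolding A(3) using card_image_le[of "{0..<m}" ?\<kappa>] by simp
  have sub: "ck ` set [0..<p] \<subseteq> U - dom ?M"
    unfolding A(3) using ck_U disj by (fastforce dest: sym)
  have "admissible_from U (m + p) v ?M ?C \<and>
    (\<forall>j\<in>set [0..<p]. foldl apply_op ?M ?C (ck j) = Some (snd \<omega> j)) \<and>
    (\<forall>k. k \<notin> ck ` set [0..<p] \<longrightarrow> foldl apply_op ?M ?C k = ?M k) \<and>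
    dom (foldl apply_op ?M ?C) = dom ?M \<union> ck ` set [0..<p]"
    using sub card A(3) ck_inj \<gamma> by (intro inserts) (simp_all add: lessThan_atLeast0)
  then have C: "admissible_from U (m + p) v ?M ?C"
    "\<And>j. j < p \<Longrightarrow> foldl apply_op ?M ?C (ck j) = Some (snd \<omega> j)"
    "\<And>k. k \<notin> ck ` {0..<p} \<Longrightarrow> foldl apply_op ?M ?C k = ?M k"
    "dom (foldl apply_op ?M ?C) = dom ?M \<union> ck ` {0..<p}"
    by simp_all
  have cont: "contents (ops1 \<omega>) = foldl apply_op ?M ?C"
    by (simp add: contents_def ops1_def)
  show "ops1 \<omega> \<in> op_sequences U (m + p) v"
    using A(1) C(1) by (simp add: op_sequences_def ops1_def admissible_from_append)
  show "contents (ops1 \<omega>) (?\<kappa> i) = Some (snd (fst \<omega> i))" if "i < m" for i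
    unfolding cont using C(3)[OF disj_img[OF that]] A(2)[OF that] by simp
  show "contents (ops1 \<omega>) (ck j) = Some (snd \<omega> j)" if "j < p" for j
    unfolding cont using C(2)[OF that] .
  show "dom (contents (ops1 \<omega>)) = ?\<kappa> ` {..<m} \<union> ck ` {..<p}"
    unfolding cont C(4) A(3) by (simp add: lessThan_atLeast0)
qed

text \<open>Deleting \<open>C\<close> makes room for the \<open>p\<close> keys of \<open>B\<close>.
  These avoid \<open>A\<close> since \<open>key\<close> separates the blocks and the absence of a
  conflict separates keys within a block.\<close>

lemma ops12:
  assumes \<tau>: "(\<omega>, c) \<in> phases m p q v"
  shows "ops1 \<omega> @ ops2 c \<in> op_sequences U (m + p) v"
    and "\<And>i. i < m \<Longrightarrow> contents (ops1 \<omega> @ ops2 c) (key i (fst (fst \<omega> i))) = Some (snd (fst \<omega> i))"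
    and "\<And>i. i < p \<Longrightarrow> contents (ops1 \<omega> @ ops2 c) (key i (fst (c i))) = Some (snd (c i))"
proof -
  let ?\<kappa> = "\<lambda>i. key i (fst (fst \<omega> i))" and ?\<kappa>' = "\<lambda>i. key i (fst (c i))"
  have \<omega>: "\<omega> \<in> first_phase m p q v" and c: "c \<in> second_phase p q v" and nc: "\<not> conflict m (fst \<omega>) c"
    using \<tau> by (auto simp: phases_def)
  note fp = first_phase_key[OF \<omega>] and sp = second_phase_key[OF c] and o1 = ops1[OF \<omega>]
  let ?M = "contents (ops1 \<omega>)"
  let ?X = "map (\<lambda>j. Delete (ck j)) [0..<p]"
  let ?B = "map (\<lambda>i. Insert (?\<kappa>' i) (snd (c i))) [0..<p]"
  let ?M' = "foldl apply_op ?M ?X"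
  have disj: "?\<kappa> i \<noteq> ck j" if "i < m" "j < p" for i j
    using key_ck fp that m_le by auto
  then have disj_img: "?\<kappa> i \<notin> ck ` {0..<p}" if "i < m" for i
    using that by (metis atLeastLessThan_iff imageE)
  have "admissible_from U (m + p) v ?M ?X \<and>
    (\<forall>k. k \<notin> ck ` set [0..<p] \<longrightarrow> ?M' k = ?M k) \<and> dom ?M' = dom ?M - ck ` set [0..<p]"
    using ck_inj o1(4) by (intro deletes) (simp_all add: lessThan_atLeast0)
  then have X: "admissible_from U (m + p) v ?M ?X"
    "\<And>k. k \<notin> ck ` {0..<p} \<Longrightarrow> ?M' k = ?M k"
    "dom ?M' = dom ?M - ck ` {0..<p}"
    by simp_all
  have dom: "dom ?M' = ?\<kappa> ` {0..<m}"
    unfolding X(3) o1(4) using disj by (auto simp: lessThan_atLeast0)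
  have inj: "inj_on ?\<kappa>' {0..<p}"
    using key_eq sp by (intro inj_onI) (metis atLeastLessThan_iff)
  have U: "?\<kappa>' ` {0..<p} \<subseteq> U"
    using key_U sp by auto
  have disj': "?\<kappa> i \<noteq> ?\<kappa>' j" if "i < m" "j < p" for i j
  proof
    assume "?\<kappa> i = ?\<kappa>' j"
    then have "i = j" "fst (fst \<omega> i) = fst (c j)"
      using key_eq[of i "fst (fst \<omega> i)" j "fst (c j)"] fp sp that m_le by auto
    then show False using nc that by (auto simp: conflict_def)
  qed
  have card: "card (dom ?M') \<le> m" unfolding dom using card_image_le[of "{0..<m}" ?\<kappa>] by simp
  have sub: "?\<kappa>' ` set [0..<p] \<subseteq> U - dom ?M'"
    unfolding dom using U disj' by fastforce
  have "admissible_from U (m + p) v ?M' ?B \<and>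
    (\<forall>i\<in>set [0..<p]. foldl apply_op ?M' ?B (?\<kappa>' i) = Some (snd (c i))) \<and>
    (\<forall>k. k \<notin> ?\<kappa>' ` set [0..<p] \<longrightarrow> foldl apply_op ?M' ?B k = ?M' k) \<and>
    dom (foldl apply_op ?M' ?B) = dom ?M' \<union> ?\<kappa>' ` set [0..<p]"
    using sub card dom inj sp by (intro inserts) simp_all
  then have B: "admissible_from U (m + p) v ?M' ?B"
    "\<And>i. i < p \<Longrightarrow> foldl apply_op ?M' ?B (?\<kappa>' i) = Some (snd (c i))"
    "\<And>k. k \<notin> ?\<kappa>' ` {0..<p} \<Longrightarrow> foldl apply_op ?M' ?B k = ?M' k"
    by simp_all
  have cont: "contents (ops1 \<omega> @ ops2 c) = foldl apply_op ?M' ?B"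
    by (simp add: contents_def ops2_def)
  show "ops1 \<omega> @ ops2 c \<in> op_sequences U (m + p) v"
    using o1(1) X(1) B(1)
    by (simp add: op_sequences_def ops2_def admissible_from_append contents_def)
  show "contents (ops1 \<omega> @ ops2 c) (?\<kappa> i) = Some (snd (fst \<omega> i))" if i: "i < m" for i
  proof -
    have "?\<kappa> i \<notin> ?\<kappa>' ` {0..<p}"
    proof
      assume "?\<kappa> i \<in> ?\<kappa>' ` {0..<p}"
      then obtain j where "j < p" "?\<kappa> i = ?\<kappa>' j" by auto
      then show False using disj'[OF i] by blast
    qed
    then show ?thesis
      unfolding cont using B(3) X(2)[OF disj_img[OF i]] o1(2)[OF i] by simp
  qed
  show "contents (ops1 \<omega> @ ops2 c) (?\<kappa>' i) = Some (snd (c i))" if "i < p" for i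
    unfolding cont using B(2)[OF that] .
qed

text \<open>For a fixed tape and fixed phase lengths the time argument is determined, so answers
  depend on the state alone. The first phase takes \<open>m + p\<close> operations, the second
  \<open>p\<close> deletions and \<open>p\<close> insertions.\<close>

lemma two_phase:
  assumes D: "dynamic_retrieval U (m + p) v M D" and \<rho>: "\<rho> \<in> space M"
    and "0 < m" "64 * m \<le> q" "4 * m * m \<le> q" "1 \<le> v"
  shows "two_phase m p q v (\<lambda>\<omega>. state_after D \<rho> (ops1 \<omega>)) (\<lambda>s c. run_from D \<rho> (m + p) s (ops2 c))
    (\<lambda>s i x. answer D \<rho> (m + p) s (key i x)) (\<lambda>s i x. answer D \<rho> (m + p + 2 * p) s (key i x))
    (\<lambda>s j. answer D \<rho> (m + p) s (ck j))"
proof -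
  have ans: "answer D \<rho> (length xs) (state_after D \<rho> xs) k = f"
    if "xs \<in> op_sequences U (m + p) v" "contents xs k = Some f" for xs k f
    using D \<rho> that by (auto simp: dynamic_retrieval_def)
  have run: "run_from D \<rho> (m + p) (state_after D \<rho> (ops1 \<omega>)) (ops2 c) = state_after D \<rho> (ops1 \<omega> @ ops2 c)"
    for \<omega> c by (simp add: state_after_def run_from_append)
  have len: "length (ops1 \<omega> @ ops2 c) = m + p + 2 * p" for \<omega> c
    by (simp add: ops2_def)
  show ?thesis
  \<comment> \<open>Cases 1 to 5 are the numerical assumptions; 6 to 9 are \<open>g1\<close>,
    \<open>gc\<close>, \<open>g2_old\<close> and \<open>g2_new\<close>.\<close>
  proof (unfold_locales, goal_cases)
    case (6 \<omega> i)
    then show ?case using ans[OF ops1(1) ops1(2)] by simp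
  next
    case (7 \<omega> i)
    then show ?case using ans[OF ops1(1) ops1(3)] by simp
  next
    case (8 \<omega> c i)
    then show ?case unfolding run using ans[OF ops12(1) ops12(2)] len by metis
  next
    case (9 \<omega> c i)
    then show ?case unfolding run using ans[OF ops12(1) ops12(3)] len by metis
  qed (use assms m_le in auto)
qed

end

lemma inj_below_card:
  assumes "infinite U \<or> N \<le> card U"
  obtains e :: "nat \<Rightarrow> 'a" where "inj_on e {..<N}" "e ` {..<N} \<subseteq> U"
proof (cases "infinite U")
  case True
  then obtain e :: "nat \<Rightarrow> 'a" where "inj e" "range e \<subseteq> U"
    using infinite_countable_subset by blast
  then show ?thesis using that[of e] by (auto intro: inj_on_subset)
next
  case False
  then obtain e :: "nat \<Rightarrow> 'a" where e: "bij_betw e {0..<card U} U"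
    using ex_bij_betw_nat_finite by blast
  have "{..<N} \<subseteq> {0..<card U}" using assms False by auto
  then have "inj_on e {..<N}" "e ` {..<N} \<subseteq> U"
    using e unfolding bij_betw_def by (blast intro: inj_on_subset)+
  then show ?thesis by (rule that)
qed

text \<open>Key \<open>x\<close> of block \<open>i\<close> gets index \<open>i * q + x\<close>, and
  \<open>C\<close> follows from index \<open>p * q\<close> on. Cubic size suffices because
  \<open>p \<le> n - 1\<close> and \<open>(n - 1) * (n ^ 2 + 1) \<le> n ^ 3\<close>.\<close>

lemma key_blocks_exist:
  assumes U: "infinite U \<or> n ^ 3 \<le> card U" and n: "2 \<le> n"
  obtains key ck where "key_blocks U (n div 2) (n - n div 2) (n ^ 2) key ck"
proof -
  define m p q where "m = n div 2" and "p = n - n div 2" and "q = n ^ 2"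
  obtain e where e: "inj_on e {..<n ^ 3}" "e ` {..<n ^ 3} \<subseteq> U"
    using inj_below_card[OF U] .
  have q: "0 < q" using n by (simp add: q_def)
  have "p \<le> n - 1" using n unfolding p_def by linarith
  then have "p * (q + 1) \<le> (n - 1) * (q + 1)" by (rule mult_right_mono) simp
  also have "\<dots> \<le> n ^ 3"
  proof -
    obtain l where "n = Suc l" using n by (cases n) auto
    then show ?thesis by (simp add: q_def power2_eq_square power3_eq_cube algebra_simps)
  qed
  finally have size: "p * q + p \<le> n ^ 3" by simp
  have idx: "i * q + x < p * q" if "i < p" "x < q" for i x
  proof -
    have "i * q + x < Suc i * q" using that by simp
    also have "\<dots> \<le> p * q" using that by (intro mult_right_mono) auto
    finally show ?thesis .
  qed
  have "key_blocks U m p q (\<lambda>i x. e (i * q + x)) (\<lambda>j. e (p * q + j))"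
  proof
    show "m \<le> p" unfolding m_def p_def by linarith
    show "e (i * q + x) \<in> U" if "i < p" "x < q" for i x
      using idx[OF that] size e(2) by (auto simp: image_subset_iff)
    show "e (p * q + j) \<in> U" if "j < p" for j
      using that size e(2) by (auto simp: image_subset_iff)
    show "i = i' \<and> x = x'" if "i < p" "x < q" "i' < p" "x' < q" "e (i * q + x) = e (i' * q + x')"
      for i x i' x'
    proof -
      have "i * q + x = i' * q + x'"
        using inj_onD[OF e(1) that(5)] idx[OF that(1,2)] idx[OF that(3,4)] size by simp
      then have "(i * q + x) div q = (i' * q + x') div q" "(i * q + x) mod q = (i' * q + x') mod q"
        by simp_all
      then show ?thesis using that q by simp
    qed
    show "inj_on (\<lambda>j. e (p * q + j)) {..<p}"
    proof (rule inj_onI)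
      fix i j assume "i \<in> {..<p}" "j \<in> {..<p}" "e (p * q + i) = e (p * q + j)"
      then show "i = j" using inj_onD[OF e(1), of "p * q + i" "p * q + j"] size by simp
    qed
    show "e (i * q + x) \<noteq> e (p * q + j)" if "i < p" "x < q" "j < p" for i x j
      using inj_onD[OF e(1), of "i * q + x" "p * q + j"] idx[OF that(1,2)] that size by auto
  qed
  then show ?thesis using that unfolding m_def p_def q_def by blast
qed

text \<open>\<open>S\<close> is fixed before \<open>M\<close> and \<open>D\<close>, so one
  distribution works against all structures. The disjunct \<open>infinite U\<close> is there because
  \<open>card\<close> is 0 on infinite sets.\<close>

theorem theorem3:
  shows "\<exists>c > (0::real). \<exists>n0 :: nat. \<forall>n \<ge> n0. \<forall>v \<ge> (1::nat). \<forall>U :: nat set.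
    infinite U \<or> n ^ 3 \<le> card U \<longrightarrow>
    (\<exists>S :: operation list pmf. set_pmf S \<subseteq> op_sequences U n v \<and>
      (\<forall>M D. dynamic_retrieval U n v M D \<longrightarrow>
        ennreal (real n * real v + c * (real n * log 2 (log 2 (real n))))
          \<le> expected_size M D S))"
proof -
  obtain n0 where n0: "\<And>n. n \<ge> n0 \<Longrightarrow> \<exists>k h. \<exists>t::real.
     8 * (1 / 48 * (real n * log 2 (log 2 (real n)))) + 20 \<le> real k \<and>
     0 \<le> 1 / 48 * (real n * log 2 (log 2 (real n))) \<and>
     8 * real h \<le> real (n div 2) * 2 powr (- (real (k + 4) / real (n div 2))) \<and>
     32 \<le> real (n div 2) * 2 powr (- (real (k + 4) / real (n div 2))) \<and>
     1 \<le> t \<and> 2 ^ (k + 4) * exp (8 * t) < t ^ h"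
    using eventually_parameters unfolding eventually_sequentially by blast
  show ?thesis
  proof (intro exI[of _ "1 / 48 :: real"] conjI exI[of _ "max n0 100"] allI impI)
    fix n v :: nat and U :: "nat set"
    assume "max n0 100 \<le> n" and v: "1 \<le> v" and U: "infinite U \<or> n ^ 3 \<le> card U"
    then have n: "n0 \<le> n" "100 \<le> n" by auto
    define m p q where "m = n div 2" and "p = n - n div 2" and "q = n ^ 2"
    define R where "R = 1 / 48 * (real n * log 2 (log 2 (real n)))"
    obtain k h and t :: real where par: "8 * R + 20 \<le> real k" "0 \<le> R"
      "8 * real h \<le> real m * 2 powr (- (real (k + 4) / real m))"
      "32 \<le> real m * 2 powr (- (real (k + 4) / real m))" "1 \<le> t" "2 ^ (k + 4) * exp (8 * t) < t ^ h"
      using n0[OF n(1)] unfolding m_def R_def by blast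
    obtain key ck where "key_blocks U m p q key ck"
      using key_blocks_exist[OF U] n unfolding m_def p_def q_def by auto
    then interpret key_blocks U m p q v key ck .
    have mp: "m + p = n" "0 < m" "2 * m \<le> n" using n unfolding m_def p_def by auto
    have "(2 * m) * (2 * m) \<le> n * n" using mp by (intro mult_mono) auto
    then have mq: "4 * m * m \<le> q" by (simp add: q_def power2_eq_square)
    have "64 * m \<le> 100 * n" using mp by simp
    also have "\<dots> \<le> n * n" using n by (intro mult_right_mono) auto
    finally have mq': "64 * m \<le> q" by (simp add: q_def power2_eq_square)
    let ?T = "phases m p q v"
    \<comment> \<open>The Boolean is the fair coin that decides whether the second phase takes
      place.\<close>
    let ?g = "\<lambda>(b, \<tau>). if b then ops1 (fst \<tau>) @ ops2 (snd \<tau>) else ops1 (fst \<tau>)"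
    let ?A = "(UNIV :: bool set) \<times> ?T"
    have g: "?g a \<in> op_sequences U n v" if in_A: "a \<in> ?A" for a
    proof -
      obtain b \<omega> c where a: "a = (b, \<omega>, c)" "(\<omega>, c) \<in> ?T" using in_A by (cases a) auto
      then have "\<omega> \<in> first_phase m p q v" by (simp add: phases_def)
      then show ?thesis
        using ops1(1) ops12(1)[OF a(2)] unfolding a(1) mp(1) by simp
    qed
    have "0 < q" using mp mq' by linarith
    then have "0 < card (first_phase m p q v) * card (second_phase p q v)"
      by (simp add: card_first_phase card_second_phase)
    then have "?T \<noteq> {}"
      using card_phases_ge[OF m_le mp(2) mq', of v] by auto
    then have A: "finite ?A" "?A \<noteq> {}" by auto
    show "\<exists>S. set_pmf S \<subseteq> op_sequences U n v \<and>
      (\<forall>M D. dynamic_retrieval U n v M D \<longrightarrow>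
        ennreal (real n * real v + 1 / 48 * (real n * log 2 (log 2 (real n)))) \<le> expected_size M D S)"
    proof (intro exI[of _ "map_pmf ?g (pmf_of_set ?A)"] conjI allI impI)
      show "set_pmf (map_pmf ?g (pmf_of_set ?A)) \<subseteq> op_sequences U n v"
        unfolding set_map_pmf set_pmf_of_set[OF A(2) A(1)] by (rule image_subsetI) (rule g)
      fix M D assume D: "dynamic_retrieval U n v M D"
      have "ennreal (real n * real v + R) \<le> expected_size M D (map_pmf ?g (pmf_of_set ?A))"
      proof (rule expected_size_uniform_ge[OF A g D])
        show "0 \<le> real n * real v + R" using par(2) by simp
        fix \<rho> assume \<rho>: "\<rho> \<in> space M"
        interpret two_phase m p q v "\<lambda>\<omega>. state_after D \<rho> (ops1 \<omega>)"
          "\<lambda>s c. run_from D \<rho> (m + p) s (ops2 c)"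
          "\<lambda>s i x. answer D \<rho> (m + p) s (key i x)" "\<lambda>s i x. answer D \<rho> (m + p + 2 * p) s (key i x)"
          "\<lambda>s j. answer D \<rho> (m + p) s (ck j)"
          using two_phase[of M D \<rho>] D \<rho> mp mq mq' v by simp
        have run: "run_from D \<rho> (m + p) (state_after D \<rho> (ops1 \<omega>)) (ops2 c)
            = state_after D \<rho> (ops1 \<omega> @ ops2 c)" for \<omega> c
          by (simp add: state_after_def run_from_append)
        have sum: "(\<Sum>a\<in>?A. real (length (state_after D \<rho> (?g a))))
            = (\<Sum>\<tau>\<in>?T. real (length (state_after D \<rho> (ops1 (fst \<tau>))))
                + real (length (state_after D \<rho> (ops1 (fst \<tau>) @ ops2 (snd \<tau>)))))"
          unfolding sum.cartesian_product' by (simp add: UNIV_bool sum.distrib)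
        show "real (card ?A) * (real n * real v + R) \<le> (\<Sum>a\<in>?A. real (length (state_after D \<rho> (?g a))))"
        proof (rule ccontr)
          \<comment> \<open>Otherwise the two lengths would average at most
            \<open>n * v + R\<close>, and \<open>two_phase_bound\<close> would contradict the choice
            of \<open>t\<close> and \<open>h\<close>.\<close>
          assume "\<not> ?thesis"
          then have "(\<Sum>\<tau>\<in>?T. real (length (state_after D \<rho> (ops1 (fst \<tau>))))
                + real (length (state_after D \<rho> (ops1 (fst \<tau>) @ ops2 (snd \<tau>)))))
              \<le> 2 * real (card ?T) * (real ((m + p) * v) + R)"
            unfolding sum mp(1) by (simp add: card_cartesian_product)
          then have "t ^ h \<le> 2 ^ (k + 4) * exp (8 * t)"
            using two_phase_bound[of R k h t] par unfolding run by blast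
          then show False using par(6) by simp
        qed
      qed
      then show "ennreal (real n * real v + 1 / 48 * (real n * log 2 (log 2 (real n))))
          \<le> expected_size M D (map_pmf ?g (pmf_of_set ?A))"
        by (simp only: R_def)
    qed
  qed simp
qed

end
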